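(* Let $S$ be Stallings' group, i.e. the kernel of the homomorphism $F_2\times F_2\times F_2\to\mathbb Z$ sending each of the six standard generators to the generator $1\in\mathbb Z$. Then $H^2(S,\mathbb ZS)=0$.
   Context: $F_2$ is the free group on two generators. The standard generators of $F_2\times F_2\times F_2$ are the six elements consisting of the two free generators of each factor. $H^2(S,\mathbb ZS)$ is the second group cohomology of $S$ with coefficients in the integral group ring $\mathbb ZS$. Stallings' group is also given (up to isomorphism) by the presentation $\langle a,b,c,d,s : [a,c]=[a,d]=[b,c]=[b,d]=1,\ a^{-1}sa=b^{-1}sb=c^{-1}sc=d^{-1}sd\rangle$. *)

theory Defs
  imports "HOL-Algebra.Free_Abelian_Groups" "HOL-Algebra.Module"
begin

section \<open>Free groups\<close>

text \<open>A letter \<open>(x, True)\<close> stands for the generator \<open>x\<close> and \<open>(x, False)\<close> for its inverse;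
  the elements of the free group are the reduced words.\<close>

definition inv_letter :: "'a \<times> bool \<Rightarrow> 'a \<times> bool"
  where "inv_letter l = (fst l, \<not> snd l)"

definition reduced :: "('a \<times> bool) list \<Rightarrow> bool"
  where "reduced w \<longleftrightarrow> successively (\<lambda>l m. m \<noteq> inv_letter l) w"

definition reduce_cons :: "'a \<times> bool \<Rightarrow> ('a \<times> bool) list \<Rightarrow> ('a \<times> bool) list"
  where "reduce_cons l w =
    (case w of [] \<Rightarrow> [l] | m # v \<Rightarrow> if m = inv_letter l then v else l # w)"

definition free_group :: "'a set \<Rightarrow> ('a \<times> bool) list monoid"
  where "free_group X =
    \<lparr>carrier = {w. reduced w \<and> fst ` set w \<subseteq> X},
     monoid.mult = foldr reduce_cons,
     one = []\<rparr>"

lemma inv_letter_simps [simp]: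
  "inv_letter (inv_letter l) = l" "fst (inv_letter l) = fst l" "snd (inv_letter l) = (\<not> snd l)"
  "inv_letter l \<noteq> l" "l \<noteq> inv_letter l"
  by (auto simp: inv_letter_def prod_eq_iff)

lemma reduced_Nil [simp]: "reduced []"
  and reduced_single [simp]: "reduced [l]"
  and reduced_Cons_Cons [simp]:
    "reduced (l # m # w) \<longleftrightarrow> m \<noteq> inv_letter l \<and> reduced (m # w)"
  by (auto simp: reduced_def)

lemma reduced_ConsD: "reduced (l # w) \<Longrightarrow> reduced w"
  by (cases w) auto

lemma reduce_cons_reduced: "reduced (l # w) \<Longrightarrow> reduce_cons l w = l # w"
  by (cases w) (auto simp: reduce_cons_def)

lemma reduced_reduce_cons: "reduced w \<Longrightarrow> reduced (reduce_cons l w)"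
  by (cases w) (auto simp: reduce_cons_def dest: reduced_ConsD)

lemma set_reduce_cons: "set (reduce_cons l w) \<subseteq> insert l (set w)"
  by (cases w) (auto simp: reduce_cons_def)

lemma reduce_cons_cancel: "reduced w \<Longrightarrow> reduce_cons l (reduce_cons (inv_letter l) w) = w"
  by (cases w; cases "tl w") (auto simp: reduce_cons_def split: if_splits)

lemma foldr_reduce_cons_Nil: "reduced w \<Longrightarrow> foldr reduce_cons w [] = w"
proof (induction w)
  case (Cons l w)
  then show ?case using reduced_ConsD[OF Cons.prems] by (simp add: reduce_cons_reduced)
qed simp

lemma reduced_foldr: "reduced v \<Longrightarrow> reduced (foldr reduce_cons u v)"
  by (induction u) (auto intro: reduced_reduce_cons)

lemma set_foldr: "set (foldr reduce_cons u v) \<subseteq> set u \<union> set v"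
  by (induction u) (use set_reduce_cons in fastforce)+

lemma foldr_reduce_cons_step:
  assumes "reduced w"
  shows "foldr reduce_cons (reduce_cons l u) w = reduce_cons l (foldr reduce_cons u w)"
proof (cases u)
  case (Cons m v)
  then show ?thesis
    using reduce_cons_cancel[of "foldr reduce_cons v w" l] assms reduced_foldr[of w v]
    by (auto simp: reduce_cons_def[of l "m # v"])
qed (simp add: reduce_cons_def[of l "[]"])

lemma foldr_reduce_cons_assoc:
  "reduced w \<Longrightarrow>
    foldr reduce_cons (foldr reduce_cons u v) w = foldr reduce_cons u (foldr reduce_cons v w)"
  by (induction u) (auto simp: foldr_reduce_cons_step)

lemma foldr_reduce_cons_inverse:
  "reduced w \<Longrightarrow> foldr reduce_cons (rev (map inv_letter u)) (foldr reduce_cons u w) = w"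
proof (induction u)
  case (Cons l u)
  then show ?case
    using reduce_cons_cancel[of "foldr reduce_cons u w" "inv_letter l"] reduced_foldr[of w u]
    by simp
qed simp

lemma group_free_group: "group (free_group X)"
proof (rule groupI)
  fix u assume u: "u \<in> carrier (free_group X)"
  let ?v = "foldr reduce_cons (rev (map inv_letter u)) []"
  have "?v \<in> carrier (free_group X)"
    using u set_foldr[of "rev (map inv_letter u)" "[]"] reduced_foldr[of "[]"]
    by (fastforce simp: free_group_def)
  moreover have "?v \<otimes>\<^bsub>free_group X\<^esub> u = \<one>\<^bsub>free_group X\<^esub>"
  proof -
    have "foldr reduce_cons ?v u = foldr reduce_cons (rev (map inv_letter u)) (foldr reduce_cons [] u)"
      using u by (subst foldr_reduce_cons_assoc) (auto simp: free_group_def)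
    also have "\<dots> = foldr reduce_cons (rev (map inv_letter u)) (foldr reduce_cons u [])"
      using u by (simp add: foldr_reduce_cons_Nil free_group_def)
    also have "\<dots> = []"
      by (rule foldr_reduce_cons_inverse) simp
    finally show ?thesis by (simp add: free_group_def)
  qed
  ultimately show "\<exists>v\<in>carrier (free_group X). v \<otimes>\<^bsub>free_group X\<^esub> u = \<one>\<^bsub>free_group X\<^esub>" by blast
next
  fix u v assume "u \<in> carrier (free_group X)" "v \<in> carrier (free_group X)"
  then show "u \<otimes>\<^bsub>free_group X\<^esub> v \<in> carrier (free_group X)"
    using set_foldr[of u v] reduced_foldr[of v u] by (fastforce simp: free_group_def)
qed (auto simp: free_group_def foldr_reduce_cons_assoc)

definition free_gen :: "'a \<Rightarrow> ('a \<times> bool) list"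
  where "free_gen x = [(x, True)]"

lemma free_gen_carrier [simp]: "x \<in> X \<Longrightarrow> free_gen x \<in> carrier (free_group X)"
  by (simp add: free_group_def free_gen_def)

lemma free_gen_inverse:
  assumes "x \<in> X"
  shows "inv\<^bsub>free_group X\<^esub> (free_gen x) = [(x, False)]"
proof -
  interpret group "free_group X" by (rule group_free_group)
  show ?thesis
    using assms
    by (intro inv_equality) (auto simp: free_group_def free_gen_def reduce_cons_def inv_letter_def)
qed

text \<open>The universal property.\<close>

definition free_lift :: "('b, 'm) monoid_scheme \<Rightarrow> ('a \<Rightarrow> 'b) \<Rightarrow> ('a \<times> bool) list \<Rightarrow> 'b"
  where "free_lift H f w =
    foldr (\<lambda>l y. (if snd l then f (fst l) else inv\<^bsub>H\<^esub> (f (fst l))) \<otimes>\<^bsub>H\<^esub> y) w \<one>\<^bsub>H\<^esub>"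

lemma free_lift_simps [simp]:
  "free_lift H f [] = \<one>\<^bsub>H\<^esub>"
  "free_lift H f (l # w) =
    (if snd l then f (fst l) else inv\<^bsub>H\<^esub> (f (fst l))) \<otimes>\<^bsub>H\<^esub> free_lift H f w"
  by (simp_all add: free_lift_def)

lemma free_lift_closed:
  assumes "group H" "f \<in> X \<rightarrow> carrier H" "fst ` set w \<subseteq> X"
  shows "free_lift H f w \<in> carrier H"
proof -
  interpret group H by fact
  show ?thesis using assms(2,3) by (induction w) auto
qed

lemma free_lift_reduce_cons:
  assumes "group H" "f \<in> X \<rightarrow> carrier H" "fst ` set (l # w) \<subseteq> X"
  shows "free_lift H f (reduce_cons l w) = free_lift H f (l # w)"
proof -
  interpret group H by fact
  show ?thesis
  proof (cases w)
    case (Cons m v)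
    then have "free_lift H f v \<in> carrier H" "f (fst l) \<in> carrier H"
      using assms free_lift_closed[of H f X v] by auto
    then show ?thesis
      using Cons by (auto simp: reduce_cons_def m_assoc[symmetric])
  qed (simp add: reduce_cons_def)
qed

lemma free_lift_hom:
  assumes "group H" "f \<in> X \<rightarrow> carrier H"
  shows "free_lift H f \<in> hom (free_group X) H"
proof -
  interpret group H by fact
  have *: "free_lift H f (foldr reduce_cons u v) = free_lift H f u \<otimes>\<^bsub>H\<^esub> free_lift H f v"
    if "fst ` set u \<subseteq> X" "fst ` set v \<subseteq> X" for u v
    using that
  proof (induction u)
    case (Cons l u)
    have "fst ` set (l # foldr reduce_cons u v) \<subseteq> X"
      using Cons.prems set_foldr[of u v] by fastforce
    moreover have "f (fst l) \<in> carrier H" "free_lift H f u \<in> carrier H" "free_lift H f v \<in> carrier H"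
      using Cons.prems assms free_lift_closed[of H f X] by auto
    ultimately show ?case
      using Cons free_lift_reduce_cons[OF assms] by (auto simp: m_assoc)
  qed (use assms free_lift_closed[of H f X v] in simp)
  show ?thesis
    by (rule homI) (use * free_lift_closed[OF assms] in \<open>auto simp: free_group_def\<close>)
qed

lemma free_lift_gen:
  assumes "group H" "f x \<in> carrier H"
  shows "free_lift H f (free_gen x) = f x"
proof -
  interpret group H by fact
  show ?thesis using assms by (simp add: free_gen_def)
qed

lemma free_lift_unique:
  assumes "group H" "h \<in> hom (free_group X) H" "\<And>x. x \<in> X \<Longrightarrow> h (free_gen x) = f x"
    and "w \<in> carrier (free_group X)"
  shows "h w = free_lift H f w"
proof -
  interpret F: group "free_group X" by (rule group_free_group)
  interpret group_hom "free_group X" H h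
    using assms by (simp add: group_hom_def group_hom_axioms_def group_free_group)
  show ?thesis
    using assms(4)
  proof (induction w)
    case Nil
    then show ?case using hom_one by (simp add: free_group_def)
  next
    case (Cons l w)
    have x: "fst l \<in> X" and w: "w \<in> carrier (free_group X)" and r: "reduced (l # w)"
      using Cons.prems by (auto simp: free_group_def dest: reduced_ConsD)
    have l: "[l] \<in> carrier (free_group X)" using x by (simp add: free_group_def)
    have "h (l # w) = h ([l] \<otimes>\<^bsub>free_group X\<^esub> w)"
      by (simp add: free_group_def reduce_cons_reduced[OF r])
    also have "\<dots> = h [l] \<otimes>\<^bsub>H\<^esub> free_lift H f w"
      using l w Cons.IH by simp
    also have "h [l] = (if snd l then f (fst l) else inv\<^bsub>H\<^esub> (f (fst l)))"
    proof (cases l)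
      case (Pair y e)
      have "h (inv\<^bsub>free_group X\<^esub> (free_gen y)) = inv\<^bsub>H\<^esub> (f y)"
        using x Pair assms(3) by (subst hom_inv) auto
      then show ?thesis
        using x Pair assms(3) free_gen_inverse[of y X] by (cases e) (auto simp: free_gen_def)
    qed
    finally show ?case by simp
  qed
qed

section \<open>Stallings' group\<close>

abbreviation F\<^sub>2 :: "(bool \<times> bool) list monoid"
  where "F\<^sub>2 \<equiv> free_group (UNIV :: bool set)"

definition exponent_sum :: "('a \<times> bool) list \<Rightarrow> int"
  where "exponent_sum w = (\<Sum>l\<leftarrow>w. if snd l then 1 else -1)"

definition stallings_hom ::
    "(bool \<times> bool) list \<times> (bool \<times> bool) list \<times> (bool \<times> bool) list \<Rightarrow> int"
  where "stallings_hom = (\<lambda>(u, v, w). exponent_sum u + exponent_sum v + exponent_sum w)"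

definition stallings_group ::
    "((bool \<times> bool) list \<times> (bool \<times> bool) list \<times> (bool \<times> bool) list) monoid"
  where "stallings_group =
    (F\<^sub>2 \<times>\<times> F\<^sub>2 \<times>\<times> F\<^sub>2)\<lparr>carrier := kernel (F\<^sub>2 \<times>\<times> F\<^sub>2 \<times>\<times> F\<^sub>2) integer_group stallings_hom\<rparr>"

lemma exponent_sum_eq_free_lift: "exponent_sum w = free_lift integer_group (\<lambda>_. 1) w"
  by (induction w) (auto simp: exponent_sum_def)

lemma group_F2_cubed: "group (F\<^sub>2 \<times>\<times> F\<^sub>2 \<times>\<times> F\<^sub>2)"
  by (intro DirProd_group group_free_group)

lemma stallings_hom_hom: "stallings_hom \<in> hom (F\<^sub>2 \<times>\<times> F\<^sub>2 \<times>\<times> F\<^sub>2) integer_group"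
proof -
  have "exponent_sum \<in> hom F\<^sub>2 integer_group"
    unfolding exponent_sum_eq_free_lift[abs_def] by (rule free_lift_hom) auto
  then show ?thesis
    by (auto simp: hom_def stallings_hom_def)
qed

lemma stallings_hom_generators:
  "stallings_hom (free_gen x, [], []) = 1"
  "stallings_hom ([], free_gen x, []) = 1"
  "stallings_hom ([], [], free_gen x) = 1"
  by (auto simp: stallings_hom_def exponent_sum_def free_gen_def)

lemma stallings_hom_unique:
  assumes h: "h \<in> hom (F\<^sub>2 \<times>\<times> F\<^sub>2 \<times>\<times> F\<^sub>2) integer_group"
    and gens: "\<And>x. h (free_gen x, [], []) = 1" "\<And>x. h ([], free_gen x, []) = 1"
      "\<And>x. h ([], [], free_gen x) = 1"
    and p: "p \<in> carrier (F\<^sub>2 \<times>\<times> F\<^sub>2 \<times>\<times> F\<^sub>2)"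
  shows "h p = stallings_hom p"
proof -
  have Nil [simp]: "[] \<in> carrier F\<^sub>2" and one: "\<one>\<^bsub>F\<^sub>2\<^esub> = []"
    by (auto simp: free_group_def)
  interpret F: group F\<^sub>2 by (rule group_free_group)
  have unit [simp]: "w \<otimes>\<^bsub>F\<^sub>2\<^esub> [] = w" "[] \<otimes>\<^bsub>F\<^sub>2\<^esub> w = w" if "w \<in> carrier F\<^sub>2" for w
    using F.r_one[OF that] F.l_one[OF that] one by auto
  have mult: "h (a \<otimes>\<^bsub>F\<^sub>2\<^esub> a', b \<otimes>\<^bsub>F\<^sub>2\<^esub> b', c \<otimes>\<^bsub>F\<^sub>2\<^esub> c') = h (a, b, c) + h (a', b', c')"
    if "a \<in> carrier F\<^sub>2" "b \<in> carrier F\<^sub>2" "c \<in> carrier F\<^sub>2"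
       "a' \<in> carrier F\<^sub>2" "b' \<in> carrier F\<^sub>2" "c' \<in> carrier F\<^sub>2" for a b c a' b' c'
    using hom_mult[OF h, of "(a, b, c)" "(a', b', c')"] that by simp
  have homs: "(\<lambda>u. h (u, [], [])) \<in> hom F\<^sub>2 integer_group"
    "(\<lambda>u. h ([], u, [])) \<in> hom F\<^sub>2 integer_group"
    "(\<lambda>u. h ([], [], u)) \<in> hom F\<^sub>2 integer_group"
    using mult[of _ "[]" "[]" _ "[]" "[]"] mult[of "[]" _ "[]" "[]" _ "[]"]
      mult[of "[]" "[]" _ "[]" "[]" _]
    by (auto intro!: homI)
  obtain u v w where p': "p = (u, v, w)" "u \<in> carrier F\<^sub>2" "v \<in> carrier F\<^sub>2" "w \<in> carrier F\<^sub>2"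
    using p by auto
  have "h (u, v, w) = h (u, [], []) + (h ([], v, []) + h ([], [], w))"
    using mult[of u "[]" "[]" "[]" v w] mult[of "[]" v "[]" "[]" "[]" w] p' by simp
  moreover have "h (u, [], []) = exponent_sum u" "h ([], v, []) = exponent_sum v"
    "h ([], [], w) = exponent_sum w"
    using free_lift_unique[OF _ homs(1), of "\<lambda>_. 1" u] free_lift_unique[OF _ homs(2), of "\<lambda>_. 1" v]
      free_lift_unique[OF _ homs(3), of "\<lambda>_. 1" w] p' gens
    by (auto simp: exponent_sum_eq_free_lift)
  ultimately show ?thesis by (simp add: p' stallings_hom_def)
qed

lemma group_stallings_group: "group stallings_group"
proof -
  interpret group_hom "F\<^sub>2 \<times>\<times> F\<^sub>2 \<times>\<times> F\<^sub>2" integer_group stallings_hom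
    using group_F2_cubed stallings_hom_hom by (simp add: group_hom_def group_hom_axioms_def)
  show ?thesis
    unfolding stallings_group_def by (rule G.subgroup_imp_group[OF subgroup_kernel])
qed

section \<open>Group cohomology\<close>

text \<open>A left \<open>G\<close>-module is an additive abelian group \<open>M\<close> with an action of \<open>G\<close> by additive maps.
  The record \<^type>\<open>module\<close> serves to carry the action in its \<open>smult\<close> field; the
  multiplicative structure of \<open>M\<close> plays no role.\<close>

locale group_module = G: group G + M: abelian_group M
  for G :: "('g, 'k) monoid_scheme" and M :: "('g, 'a, 'm) module_scheme" +
  assumes act_closed: "\<lbrakk>g \<in> carrier G; x \<in> carrier M\<rbrakk> \<Longrightarrow> g \<odot>\<^bsub>M\<^esub> x \<in> carrier M"
    and act_add: "\<lbrakk>g \<in> carrier G; x \<in> carrier M; y \<in> carrier M\<rbrakk> \<Longrightarrow>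
      g \<odot>\<^bsub>M\<^esub> (x \<oplus>\<^bsub>M\<^esub> y) = g \<odot>\<^bsub>M\<^esub> x \<oplus>\<^bsub>M\<^esub> g \<odot>\<^bsub>M\<^esub> y"
    and act_one: "x \<in> carrier M \<Longrightarrow> \<one>\<^bsub>G\<^esub> \<odot>\<^bsub>M\<^esub> x = x"
    and act_mult: "\<lbrakk>g \<in> carrier G; h \<in> carrier G; x \<in> carrier M\<rbrakk> \<Longrightarrow>
      (g \<otimes>\<^bsub>G\<^esub> h) \<odot>\<^bsub>M\<^esub> x = g \<odot>\<^bsub>M\<^esub> (h \<odot>\<^bsub>M\<^esub> x)"

text \<open>Inhomogeneous cochains, i.e. the complex of \<open>G\<close>-maps into \<open>M\<close> from the bar resolution of
  the trivial module \<open>\<int>\<close>. An \<open>n\<close>-cochain is a function \<open>G\<^sup>n \<rightarrow> M\<close>, with \<open>G\<^sup>n\<close> rendered as the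
  lists of length \<open>n\<close>; its coboundary is
  \[ (\delta f)(g_0, \ldots, g_n) = g_0 f(g_1, \ldots, g_n)
     + \sum_{i<n} (-1)^{i+1} f(g_0, \ldots, g_i g_{i+1}, \ldots, g_n)
     + (-1)^{n+1} f(g_0, \ldots, g_{n-1}). \]\<close>

definition tuples :: "('g, 'k) monoid_scheme \<Rightarrow> nat \<Rightarrow> 'g list set"
  where "tuples G n = {gs. length gs = n \<and> set gs \<subseteq> carrier G}"

definition cochains ::
    "nat \<Rightarrow> ('g, 'k) monoid_scheme \<Rightarrow> ('g, 'a, 'm) module_scheme \<Rightarrow> ('g list \<Rightarrow> 'a) monoid"
  where "cochains n G M = product_group (tuples G n) (\<lambda>_. add_monoid M)"

definition merge_at :: "('g, 'k) monoid_scheme \<Rightarrow> nat \<Rightarrow> 'g list \<Rightarrow> 'g list"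
  where "merge_at G i gs = take i gs @ [gs ! i \<otimes>\<^bsub>G\<^esub> gs ! Suc i] @ drop (i + 2) gs"

definition coboundary ::
    "nat \<Rightarrow> ('g, 'k) monoid_scheme \<Rightarrow> ('g, 'a, 'm) module_scheme \<Rightarrow>
     ('g list \<Rightarrow> 'a) \<Rightarrow> 'g list \<Rightarrow> 'a"
  where "coboundary n G M f =
    (\<lambda>gs\<in>tuples G (Suc n).
      hd gs \<odot>\<^bsub>M\<^esub> f (tl gs)
      \<oplus>\<^bsub>M\<^esub> (\<Oplus>\<^bsub>M\<^esub>i\<in>{..<n}. [((-1 :: int) ^ (i + 1))] \<cdot>\<^bsub>M\<^esub> f (merge_at G i gs))
      \<oplus>\<^bsub>M\<^esub> [((-1 :: int) ^ (n + 1))] \<cdot>\<^bsub>M\<^esub> f (butlast gs))"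

definition cocycles ::
    "nat \<Rightarrow> ('g, 'k) monoid_scheme \<Rightarrow> ('g, 'a, 'm) module_scheme \<Rightarrow> ('g list \<Rightarrow> 'a) set"
  where "cocycles n G M = kernel (cochains n G M) (cochains (Suc n) G M) (coboundary n G M)"

definition coboundaries ::
    "nat \<Rightarrow> ('g, 'k) monoid_scheme \<Rightarrow> ('g, 'a, 'm) module_scheme \<Rightarrow> ('g list \<Rightarrow> 'a) set"
  where "coboundaries n G M =
    (case n of 0 \<Rightarrow> {\<one>\<^bsub>cochains 0 G M\<^esub>}
     | Suc m \<Rightarrow> coboundary m G M ` carrier (cochains m G M))"

definition group_cohomology ::
    "nat \<Rightarrow> ('g, 'k) monoid_scheme \<Rightarrow> ('g, 'a, 'm) module_scheme \<Rightarrow> ('g list \<Rightarrow> 'a) set monoid"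
  where "group_cohomology n G M =
    (cochains n G M)\<lparr>carrier := cocycles n G M\<rparr> Mod coboundaries n G M"

context group_module
begin

lemma sign_simps:
  assumes "x \<in> carrier M"
  shows "[(1 :: int)] \<cdot>\<^bsub>M\<^esub> x = x" "[(- 1 :: int)] \<cdot>\<^bsub>M\<^esub> x = \<ominus>\<^bsub>M\<^esub> x"
  using assms M.add.int_pow_neg[of x 1] M.add.int_pow_1[of x] by simp_all

lemma coboundary_1:
  assumes "f \<in> carrier (cochains 1 G M)" "g \<in> carrier G" "h \<in> carrier G"
  shows "coboundary 1 G M f [g, h] =
    g \<odot>\<^bsub>M\<^esub> f [h] \<ominus>\<^bsub>M\<^esub> f [g \<otimes>\<^bsub>G\<^esub> h] \<oplus>\<^bsub>M\<^esub> f [g]"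
proof -
  have f: "f [x] \<in> carrier M" if "x \<in> carrier G" for x
    using assms(1) that by (auto simp: cochains_def tuples_def PiE_iff)
  show ?thesis
    using assms(2,3) f
    by (simp add: coboundary_def tuples_def merge_at_def lessThan_Suc a_minus_def sign_simps
        M.finsum_insert)
qed

lemma coboundary_2:
  assumes "f \<in> carrier (cochains 2 G M)" "g \<in> carrier G" "h \<in> carrier G" "k \<in> carrier G"
  shows "coboundary 2 G M f [g, h, k] =
    g \<odot>\<^bsub>M\<^esub> f [h, k] \<ominus>\<^bsub>M\<^esub> f [g \<otimes>\<^bsub>G\<^esub> h, k] \<oplus>\<^bsub>M\<^esub> f [g, h \<otimes>\<^bsub>G\<^esub> k] \<ominus>\<^bsub>M\<^esub> f [g, h]"
proof -
  have f: "f [x, y] \<in> carrier M" if "x \<in> carrier G" "y \<in> carrier G" for x y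
    using assms(1) that by (auto simp: cochains_def tuples_def PiE_iff)
  have "{..<2} = {0, Suc 0}" by auto
  then show ?thesis
    using assms(2-4) f act_closed
    by (simp add: coboundary_def tuples_def merge_at_def a_minus_def sign_simps M.a_ac
        M.finsum_insert)
qed

end

section \<open>The integral group ring\<close>

definition group_ring :: "('g, 'k) monoid_scheme \<Rightarrow> ('g \<Rightarrow>\<^sub>0 int) ring"
  where "group_ring G =
    \<lparr>carrier = carrier (free_Abelian_group (carrier G)),
     monoid.mult = (\<lambda>x y. frag_extend (\<lambda>g. frag_extend (\<lambda>h. frag_of (g \<otimes>\<^bsub>G\<^esub> h)) y) x),
     one = frag_of \<one>\<^bsub>G\<^esub>,
     zero = 0,
     add = (+)\<rparr>"

text \<open>The group ring as a left \<open>G\<close>-module.\<close>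

definition group_ring_module :: "('g, 'k) monoid_scheme \<Rightarrow> ('g, 'g \<Rightarrow>\<^sub>0 int) module"
  where "group_ring_module G =
    ring.extend (group_ring G)
      (module.fields (\<lambda>g x. frag_of g \<otimes>\<^bsub>group_ring G\<^esub> x))"

lemma group_ring_simps [simp]:
  "carrier (group_ring G) = {x. Poly_Mapping.keys x \<subseteq> carrier G}"
  "\<zero>\<^bsub>group_ring G\<^esub> = 0" "\<one>\<^bsub>group_ring G\<^esub> = frag_of \<one>\<^bsub>G\<^esub>" "x \<oplus>\<^bsub>group_ring G\<^esub> y = x + y"
  by (simp_all add: group_ring_def free_Abelian_group_def)

lemma group_ring_mult_of:
  "frag_of g \<otimes>\<^bsub>group_ring G\<^esub> frag_of h = frag_of (g \<otimes>\<^bsub>G\<^esub> h)"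
  by (simp add: group_ring_def)

lemma group_ring_mult_distrib:
  "(x + y) \<otimes>\<^bsub>group_ring G\<^esub> z = x \<otimes>\<^bsub>group_ring G\<^esub> z + y \<otimes>\<^bsub>group_ring G\<^esub> z"
  "(x - y) \<otimes>\<^bsub>group_ring G\<^esub> z = x \<otimes>\<^bsub>group_ring G\<^esub> z - y \<otimes>\<^bsub>group_ring G\<^esub> z"
  "0 \<otimes>\<^bsub>group_ring G\<^esub> z = 0"
  by (simp_all add: group_ring_def frag_extend_add frag_extend_diff)

lemma group_ring_mult_distrib':
  "z \<otimes>\<^bsub>group_ring G\<^esub> (x + y) = z \<otimes>\<^bsub>group_ring G\<^esub> x + z \<otimes>\<^bsub>group_ring G\<^esub> y" (is ?A)
  "z \<otimes>\<^bsub>group_ring G\<^esub> (x - y) = z \<otimes>\<^bsub>group_ring G\<^esub> x - z \<otimes>\<^bsub>group_ring G\<^esub> y" (is ?B)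
  "z \<otimes>\<^bsub>group_ring G\<^esub> 0 = 0" (is ?C)
proof -
  have z: "Poly_Mapping.keys z \<subseteq> UNIV" by simp
  show ?A using z
    by (induction z rule: frag_induction)
      (simp_all add: group_ring_mult_distrib, simp add: group_ring_def frag_extend_add)
  show ?B using z
    by (induction z rule: frag_induction)
      (simp_all add: group_ring_mult_distrib, simp add: group_ring_def frag_extend_diff)
  show ?C using z
    by (induction z rule: frag_induction)
      (simp_all add: group_ring_mult_distrib, simp add: group_ring_def)
qed

lemma ring_group_ring:
  assumes "group G"
  shows "ring (group_ring G)"
proof -
  interpret group G by fact
  let ?R = "group_ring G"
  have closed: "x \<otimes>\<^bsub>?R\<^esub> y \<in> carrier ?R" if x: "x \<in> carrier ?R" and y: "y \<in> carrier ?R" for x y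
  proof -
    have diff: "Poly_Mapping.keys (a - b) \<subseteq> carrier G"
      if "Poly_Mapping.keys a \<subseteq> carrier G" "Poly_Mapping.keys b \<subseteq> carrier G"
      for a b :: "'a \<Rightarrow>\<^sub>0 int"
      using keys_diff[of a b] that by blast
    have of: "Poly_Mapping.keys (frag_of g \<otimes>\<^bsub>?R\<^esub> y) \<subseteq> carrier G" if g: "g \<in> carrier G" for g
      using y[simplified]
      by (induction y rule: frag_induction)
        (simp_all add: g diff group_ring_mult_of group_ring_mult_distrib')
    have "Poly_Mapping.keys (x \<otimes>\<^bsub>?R\<^esub> y) \<subseteq> carrier G"
      using x[simplified]
      by (induction x rule: frag_induction) (simp_all add: of diff group_ring_mult_distrib)
    then show ?thesis by simp
  qed
  have assoc: "(x \<otimes>\<^bsub>?R\<^esub> y) \<otimes>\<^bsub>?R\<^esub> z = x \<otimes>\<^bsub>?R\<^esub> (y \<otimes>\<^bsub>?R\<^esub> z)"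
    if x: "x \<in> carrier ?R" and y: "y \<in> carrier ?R" and z: "z \<in> carrier ?R" for x y z
    using x[simplified]
  proof (induction x rule: frag_induction)
    case (one g)
    show ?case using y[simplified]
    proof (induction y rule: frag_induction)
      case (one h)
      show ?case using z[simplified] \<open>g \<in> carrier G\<close> one
        by (induction z rule: frag_induction)
          (simp_all add: group_ring_mult_of group_ring_mult_distrib' m_assoc)
    qed (simp_all add: group_ring_mult_distrib group_ring_mult_distrib')
  qed (simp_all add: group_ring_mult_distrib)
  have l_one: "frag_of \<one>\<^bsub>G\<^esub> \<otimes>\<^bsub>?R\<^esub> x = x" and r_one: "x \<otimes>\<^bsub>?R\<^esub> frag_of \<one>\<^bsub>G\<^esub> = x"
    if "x \<in> carrier ?R" for x
    using that[simplified]
    by (induction x rule: frag_induction)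
      (simp_all add: group_ring_mult_of group_ring_mult_distrib group_ring_mult_distrib')
  show ?thesis
  proof (rule ringI)
    show "abelian_group ?R"
    proof (rule abelian_groupI)
      fix x assume "x \<in> carrier ?R"
      then show "\<exists>y\<in>carrier ?R. y \<oplus>\<^bsub>?R\<^esub> x = \<zero>\<^bsub>?R\<^esub>"
        by (intro bexI[of _ "- x"]) auto
    next
      fix x y assume "x \<in> carrier ?R" "y \<in> carrier ?R"
      then show "x \<oplus>\<^bsub>?R\<^esub> y \<in> carrier ?R" using keys_add[of x y] by auto
    qed (auto simp: ac_simps)
    show "Group.monoid ?R"
      by (rule monoidI) (use closed assoc l_one r_one in auto)
  qed (simp_all add: group_ring_mult_distrib group_ring_mult_distrib')
qed

lemma group_ring_module_simps [simp]:
  "carrier (group_ring_module G) = carrier (group_ring G)"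
  "monoid.mult (group_ring_module G) = monoid.mult (group_ring G)"
  "\<one>\<^bsub>group_ring_module G\<^esub> = \<one>\<^bsub>group_ring G\<^esub>"
  "add (group_ring_module G) = add (group_ring G)"
  "\<zero>\<^bsub>group_ring_module G\<^esub> = \<zero>\<^bsub>group_ring G\<^esub>"
  "g \<odot>\<^bsub>group_ring_module G\<^esub> x = frag_of g \<otimes>\<^bsub>group_ring G\<^esub> x"
  by (simp_all add: group_ring_module_def group_ring_def ring.defs module.defs)

lemma group_module_group_ring:
  assumes "group G"
  shows "group_module G (group_ring_module G)"
proof -
  interpret G: group G by fact
  interpret R: ring "group_ring G" by (rule ring_group_ring) fact
  have M: "abelian_group (group_ring_module G)"
  proof (rule abelian_groupI)
    fix x assume "x \<in> carrier (group_ring_module G)"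
    then show "\<exists>y\<in>carrier (group_ring_module G).
        y \<oplus>\<^bsub>group_ring_module G\<^esub> x = \<zero>\<^bsub>group_ring_module G\<^esub>"
      by (intro bexI[of _ "- x"]) auto
  next
    fix x y assume "x \<in> carrier (group_ring_module G)" "y \<in> carrier (group_ring_module G)"
    then show "x \<oplus>\<^bsub>group_ring_module G\<^esub> y \<in> carrier (group_ring_module G)"
      using R.a_closed[of x y] by simp
  qed (simp_all add: ac_simps)
  show ?thesis
  proof (intro group_module.intro group_module_axioms.intro)
    show "group G" by fact
    show "abelian_group (group_ring_module G)" by (rule M)
  next
    fix g h x assume *: "g \<in> carrier G" "h \<in> carrier G" "x \<in> carrier (group_ring_module G)"
    then show "(g \<otimes>\<^bsub>G\<^esub> h) \<odot>\<^bsub>group_ring_module G\<^esub> x =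
        g \<odot>\<^bsub>group_ring_module G\<^esub> (h \<odot>\<^bsub>group_ring_module G\<^esub> x)"
      using R.m_assoc[of "frag_of g" "frag_of h" x] by (simp add: group_ring_mult_of)
  next
    fix g x assume "g \<in> carrier G" "x \<in> carrier (group_ring_module G)"
    then show "g \<odot>\<^bsub>group_ring_module G\<^esub> x \<in> carrier (group_ring_module G)"
      using R.m_closed[of "frag_of g" x] by simp
  next
    fix x assume "x \<in> carrier (group_ring_module G)"
    then show "\<one>\<^bsub>G\<^esub> \<odot>\<^bsub>group_ring_module G\<^esub> x = x"
      using R.l_one[of x] by simp
  qed (simp add: group_ring_mult_distrib')
qed

end

theory Submission
  imports Defs "HOL-Library.Function_Algebras"
begin

text \<open>Embed \<open>\<int>G\<close> into the module of all functions \<open>G \<rightarrow> \<int>\<close>, which is coinduced: there every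
  2-cocycle \<open>f\<close> with values in \<open>\<int>G\<close> is the coboundary of some \<open>b\<close>, and \<open>f\<close> is a coboundary over
  \<open>\<int>G\<close> as soon as \<open>b\<close> differs from a derivation by \<open>\<int>G\<close>-valued corrections.

  Stallings' group contains elements \<open>z\<^sub>0, z\<^sub>1, z\<^sub>2\<close>, one in each factor, whose conjugacy classes
  commute with one another, and \<open>z\<^sub>0 - 1, z\<^sub>1 - 1, z\<^sub>2 - 1\<close> act on \<open>\<int>G\<close> as a regular sequence. The
  latter makes the Koszul complex exact in degrees below three. Degree two allows to correct
  \<open>b z\<^sub>i\<close> to values \<open>\<psi> i\<close> that satisfy \<open>(z\<^sub>i - 1) \<psi> j = (z\<^sub>j - 1) \<psi> i\<close> exactly; degrees zero and one give
  unique corrections, first of \<open>b\<close> on the normal subsets \<open>X\<^sub>i \<ni> z\<^sub>i\<close> and then on all of \<open>G\<close>.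
  Uniqueness forces the corrected map to be a derivation.\<close>

section \<open>Lifting derivations along a regular sequence\<close>

text \<open>\<open>A\<close> is a submodule of an ambient module that fills the type
  \<open>'v\<close>. There is no law for \<open>act \<one>\<close>: the action used later,
  \<open>translate\<close>, sets values outside the carrier to 0 even for
  \<open>\<one>\<close>.\<close>

locale relative_module = group G for G (structure) +
  fixes act :: "'a \<Rightarrow> 'v::ab_group_add \<Rightarrow> 'v" and A :: "'v set"
  assumes act_diff: "g \<in> carrier G \<Longrightarrow> act g (v - w) = act g v - act g w"
    and act_mult: "\<lbrakk>g \<in> carrier G; h \<in> carrier G\<rbrakk> \<Longrightarrow> act (g \<otimes> h) v = act g (act h v)"
    and zero_mem: "0 \<in> A"
    and diff_mem: "\<lbrakk>v \<in> A; w \<in> A\<rbrakk> \<Longrightarrow> v - w \<in> A"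
    and act_mem: "\<lbrakk>g \<in> carrier G; v \<in> A\<rbrakk> \<Longrightarrow> act g v \<in> A"
begin

text \<open>The action of the group ring element \<open>g - 1\<close>.\<close>

definition D :: "'a \<Rightarrow> 'v \<Rightarrow> 'v"
  where "D g v = act g v - v"

lemma add_mem: "\<lbrakk>v \<in> A; w \<in> A\<rbrakk> \<Longrightarrow> v + w \<in> A"
  using diff_mem[OF _ diff_mem[OF zero_mem]] by fastforce

lemma D_mem: "\<lbrakk>g \<in> carrier G; v \<in> A\<rbrakk> \<Longrightarrow> D g v \<in> A"
  by (simp add: D_def act_mem diff_mem)

lemma act_zero: "g \<in> carrier G \<Longrightarrow> act g 0 = 0"
  using act_diff[of g 0 0] by simp

lemma act_add: "g \<in> carrier G \<Longrightarrow> act g (v + w) = act g v + act g w"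
  using act_diff[of g "v + w" w] by (simp add: algebra_simps)

lemma D_diff: "g \<in> carrier G \<Longrightarrow> D g (v - w) = D g v - D g w"
  by (simp add: D_def act_diff)

lemma D_add: "g \<in> carrier G \<Longrightarrow> D g (v + w) = D g v + D g w"
  by (simp add: D_def act_add)

lemma D_zero: "g \<in> carrier G \<Longrightarrow> D g 0 = 0"
  by (simp add: D_def act_zero)

lemma act_D_commute:
  assumes "g \<in> carrier G" "h \<in> carrier G" "g \<otimes> h = h \<otimes> g"
  shows "act g (D h v) = D h (act g v)"
  using assms act_mult[of g h v] act_mult[of h g v] by (simp add: D_def act_diff)

lemma D_commute:
  assumes "g \<in> carrier G" "h \<in> carrier G" "g \<otimes> h = h \<otimes> g"
  shows "D g (D h v) = D h (D g v)"
  using act_D_commute[OF assms] assms by (simp add: D_def[of g] D_diff)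

text \<open>As y g = g (g^-1 y g), moving \<open>y - 1\<close> past \<open>g\<close> conjugates
  \<open>y\<close>; this is why the sets \<open>X i\<close> below are closed under
  conjugation.\<close>

lemma D_act_conj:
  assumes "g \<in> carrier G" "y \<in> carrier G"
  shows "D y (act g v) = act g (D (inv g \<otimes> y \<otimes> g) v)"
proof -
  have "g \<otimes> (inv g \<otimes> y \<otimes> g) = y \<otimes> g"
    using assms by (simp add: m_assoc[symmetric])
  then show ?thesis
    using assms act_mult[of g "inv g \<otimes> y \<otimes> g" v] act_mult[of y g v]
    by (simp add: D_def act_diff)
qed

end

text \<open>The \<open>regular\<close> assumptions say that \<open>z i - 1\<close> is injective on
  \<open>A\<close>, on \<open>A\<close> modulo the image of another \<open>z j - 1\<close>, and, for
  \<open>i = 2\<close>, on \<open>A\<close> modulo the images of both others.\<close>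

locale commuting_regular = relative_module G act A
  for G (structure) and act :: "'a \<Rightarrow> 'v::ab_group_add \<Rightarrow> 'v" and A +
  fixes z :: "nat \<Rightarrow> 'a" and X :: "nat \<Rightarrow> 'a set"
  assumes z_mem: "i < 3 \<Longrightarrow> z i \<in> X i"
    and X_carrier: "i < 3 \<Longrightarrow> X i \<subseteq> carrier G"
    and X_conj: "\<lbrakk>i < 3; x \<in> X i; g \<in> carrier G\<rbrakk> \<Longrightarrow> inv g \<otimes> x \<otimes> g \<in> X i"
    and X_commute: "\<lbrakk>i < 3; j < 3; i \<noteq> j; x \<in> X i; y \<in> X j\<rbrakk> \<Longrightarrow> x \<otimes> y = y \<otimes> x"
    and regular_1: "\<lbrakk>i < 3; a \<in> A; D (z i) a = 0\<rbrakk> \<Longrightarrow> a = 0"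
    and regular_2: "\<lbrakk>i < 3; j < 3; i \<noteq> j; a \<in> A; b \<in> A; D (z i) a = D (z j) b\<rbrakk> \<Longrightarrow>
      \<exists>c\<in>A. a = D (z j) c"
    and regular_3: "\<lbrakk>a \<in> A; b \<in> A; c \<in> A; D (z 2) a = D (z 0) b + D (z 1) c\<rbrakk> \<Longrightarrow>
      \<exists>b'\<in>A. \<exists>c'\<in>A. a = D (z 0) b' + D (z 1) c'"
begin

section \<open>Koszul exactness in degrees one and two\<close>

lemma X_closed: "\<lbrakk>i < 3; x \<in> X i\<rbrakk> \<Longrightarrow> x \<in> carrier G"
  using X_carrier by blast

lemma z_closed: "i < 3 \<Longrightarrow> z i \<in> carrier G"
  using X_closed z_mem by blast

lemma D_X_commute:
  "\<lbrakk>i < 3; j < 3; i \<noteq> j; x \<in> X i; y \<in> X j\<rbrakk> \<Longrightarrow> D x (D y v) = D y (D x v)"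
  by (intro D_commute X_commute[of i j] X_closed) auto

text \<open>Exactness in degree one for two of the elements: \<open>regular_2\<close> divides
  \<open>a\<close> by \<open>z i - 1\<close>, and cancelling \<open>z i - 1\<close> shows that the
  same \<open>c\<close> serves \<open>b\<close>.\<close>

lemma z_primitive:
  assumes ij: "i < 3" "j < 3" "i \<noteq> j" and ab: "a \<in> A" "b \<in> A"
    and eq: "D (z j) a = D (z i) b"
  obtains c where "c \<in> A" "a = D (z i) c" "b = D (z j) c"
proof -
  obtain c where c: "c \<in> A" "a = D (z i) c"
    using regular_2[of j i a b] assms by metis
  have "D (z i) (b - D (z j) c) = 0"
    using eq c ij D_X_commute[of i j "z i" "z j" c] z_mem by (simp add: D_diff z_closed)
  then have "b = D (z j) c"
    using regular_1[of i "b - D (z j) c"] ij ab c by (simp add: diff_mem D_mem z_closed)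
  then show ?thesis using that c by blast
qed

text \<open>Exactness in degree two: \<open>p\<close>, \<open>q\<close>, \<open>r\<close> carry the
  indices 01, 02, 12, and \<open>a\<close>, \<open>b\<close>, \<open>c\<close> the indices 0, 1, 2.
  \<open>regular_3\<close> solves for \<open>p\<close>; what then remains of \<open>q\<close> and
  \<open>r\<close> is a pair for \<open>z_primitive\<close>.\<close>

lemma koszul_2:
  assumes mem: "p \<in> A" "q \<in> A" "r \<in> A"
    and eq: "D (z 2) p - D (z 1) q + D (z 0) r = 0"
  obtains a b c where "a \<in> A" "b \<in> A" "c \<in> A"
    "p = D (z 0) b - D (z 1) a" "q = D (z 0) c - D (z 2) a" "r = D (z 1) c - D (z 2) b"
proof -
  have cl: "z 0 \<in> carrier G" "z 1 \<in> carrier G" "z 2 \<in> carrier G"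
    using z_closed by auto
  have comm: "D (z 1) (D (z 0) v) = D (z 0) (D (z 1) v)"
    "D (z 2) (D (z 0) v) = D (z 0) (D (z 2) v)"
    "D (z 2) (D (z 1) v) = D (z 1) (D (z 2) v)" for v
    using D_X_commute[of 1 0 "z 1" "z 0"] D_X_commute[of 2 0 "z 2" "z 0"]
      D_X_commute[of 2 1 "z 2" "z 1"] z_mem by auto
  have neg: "D (z 0) (0 - r) = - D (z 0) r"
    using cl by (simp add: D_diff D_zero del: diff_0)
  have "D (z 2) p = D (z 0) (0 - r) + D (z 1) q"
    using eq unfolding neg by (simp add: algebra_simps)
  then obtain b a' where b: "b \<in> A" "a' \<in> A" "p = D (z 0) b + D (z 1) a'"
    using regular_3[of p "0 - r" q] mem diff_mem[OF zero_mem mem(3)] by blast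
  define a where "a = 0 - a'"
  have a: "a \<in> A" "p = D (z 0) b - D (z 1) a"
    using b cl diff_mem zero_mem by (auto simp: a_def D_diff D_zero simp del: diff_0)
  have "D (z 1) (q + D (z 2) a) = D (z 0) (r + D (z 2) b)"
    using eq cl unfolding a(2)
    by (simp add: D_add D_diff comm algebra_simps del: One_nat_def)
  then obtain c where "c \<in> A" "q + D (z 2) a = D (z 0) c" "r + D (z 2) b = D (z 1) c"
    using z_primitive[of 0 1 "q + D (z 2) a" "r + D (z 2) b"] mem a b cl
    by (auto simp: add_mem D_mem)
  then show ?thesis
    using that[of a b c] a b by (simp add: algebra_simps)
qed

section \<open>Lifting derivations modulo \<open>A\<close>\<close>

context
  fixes b :: "'a \<Rightarrow> 'v"
  \<comment> \<open>\<open>b\<close> is a derivation modulo \<open>A\<close>: its coboundary takes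
    values in \<open>A\<close>.\<close>
  assumes b: "\<And>g h. \<lbrakk>g \<in> carrier G; h \<in> carrier G\<rbrakk> \<Longrightarrow> act g (b h) - b (g \<otimes> h) + b g \<in> A"
begin

text \<open>Expand \<open>b\<close> at y g = g (g^-1 y g) in two ways and subtract. For a true
  derivation the expression is 0.\<close>

lemma b_conj:
  assumes "g \<in> carrier G" "y \<in> carrier G"
  shows "D y (b g) - act g (b (inv g \<otimes> y \<otimes> g)) + b y \<in> A"
proof -
  have "g \<otimes> (inv g \<otimes> y \<otimes> g) = y \<otimes> g"
    using assms by (simp add: m_assoc[symmetric])
  then show ?thesis
    using diff_mem[OF b[of y g] b[of g "inv g \<otimes> y \<otimes> g"]] assms
    by (simp add: D_def algebra_simps)
qed

lemma b_commute:
  assumes "x \<in> carrier G" "y \<in> carrier G" "x \<otimes> y = y \<otimes> x"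
  shows "D x (b y) - D y (b x) \<in> A"
  using diff_mem[OF b[of x y] b[of y x]] assms by (simp add: D_def algebra_simps)

text \<open>The failures of symmetry \<open>p i j\<close> form a Koszul 2-cocycle in
  \<open>A\<close>; subtracting a primitive of it from the \<open>b (z i)\<close> restores
  symmetry.\<close>

lemma lift_z:
  obtains \<psi> where "\<And>i. i < 3 \<Longrightarrow> \<psi> i - b (z i) \<in> A"
    "\<And>i j. \<lbrakk>i < 3; j < 3\<rbrakk> \<Longrightarrow> D (z i) (\<psi> j) = D (z j) (\<psi> i)"
proof -
  have cl: "z 0 \<in> carrier G" "z 1 \<in> carrier G" "z 2 \<in> carrier G"
    using z_closed by auto
  have comm: "D (z 1) (D (z 0) v) = D (z 0) (D (z 1) v)"
    "D (z 2) (D (z 0) v) = D (z 0) (D (z 2) v)"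
    "D (z 2) (D (z 1) v) = D (z 1) (D (z 2) v)" for v
    using D_X_commute[of 1 0 "z 1" "z 0"] D_X_commute[of 2 0 "z 2" "z 0"]
      D_X_commute[of 2 1 "z 2" "z 1"] z_mem by auto
  define p where "p i j = D (z i) (b (z j)) - D (z j) (b (z i))" for i j
  have p: "p i j \<in> A" if "i < 3" "j < 3" "i \<noteq> j" for i j
    unfolding p_def using that by (intro b_commute z_closed X_commute[of i j] z_mem)
  \<comment> \<open>Since the operators commute, each double difference of a \<open>b (z m)\<close>
    occurs twice with opposite signs.\<close>
  have "D (z 2) (p 0 1) - D (z 1) (p 0 2) + D (z 0) (p 1 2) = 0"
    using cl by (simp add: p_def D_diff comm del: One_nat_def)
  then obtain a0 a1 a2 where a: "a0 \<in> A" "a1 \<in> A" "a2 \<in> A"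
    "p 0 1 = D (z 0) a1 - D (z 1) a0" "p 0 2 = D (z 0) a2 - D (z 2) a0"
    "p 1 2 = D (z 1) a2 - D (z 2) a1"
    using koszul_2[of "p 0 1" "p 0 2" "p 1 2"] p by auto
  define a where "a i = (if i = 0 then a0 else if i = 1 then a1 else a2)" for i :: nat
  have lt3: "i = 0 \<or> i = 1 \<or> i = 2" if "i < 3" for i :: nat
    using that by linarith
  show ?thesis
  proof (rule that[of "\<lambda>i. b (z i) - a i"])
    show "b (z i) - a i - b (z i) \<in> A" for i
      using diff_mem[OF zero_mem, of "a i"] a by (simp add: a_def)
    show "D (z i) (b (z j) - a j) = D (z j) (b (z i) - a i)" if "i < 3" "j < 3" for i j
      using lt3[OF that(1)] lt3[OF that(2)] a(4-6) cl
      by (auto simp: a_def p_def D_diff algebra_simps)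
  qed
qed

text \<open>Equivalently, the coboundary of \<open>b\<close> is already the coboundary of the
  \<open>A\<close>-valued map \<open>b - c\<close>.\<close>

theorem lift_to_derivation:
  obtains c where "\<And>g. g \<in> carrier G \<Longrightarrow> c g - b g \<in> A"
    "\<And>g h. \<lbrakk>g \<in> carrier G; h \<in> carrier G\<rbrakk> \<Longrightarrow> c (g \<otimes> h) = c g + act g (c h)"
proof -
  obtain \<psi> where \<psi>: "\<And>i. i < 3 \<Longrightarrow> \<psi> i - b (z i) \<in> A"
    "\<And>i j. \<lbrakk>i < 3; j < 3\<rbrakk> \<Longrightarrow> D (z i) (\<psi> j) = D (z j) (\<psi> i)"
    using lift_z by blast
  \<comment> \<open>A derivation with value \<open>\<psi> j\<close> at \<open>z j\<close> satisfies
    these equations at \<open>x\<close>, because \<open>x\<close> commutes with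
    \<open>z j\<close>.\<close>
  have "\<exists>v. v - b x \<in> A \<and> (\<forall>j<3. j \<noteq> i \<longrightarrow> D (z j) v = D x (\<psi> j))"
    if i: "i < 3" and x: "x \<in> X i" for i x
  proof -
    obtain j k :: nat where jk: "j < 3" "k < 3" "j \<noteq> i" "k \<noteq> i" "j \<noteq> k"
      and all: "\<And>l. \<lbrakk>l < 3; l \<noteq> i\<rbrakk> \<Longrightarrow> l = j \<or> l = k"
    proof -
      consider "i = 0" | "i = 1" | "i = 2" using i by linarith
      then show ?thesis
      proof cases
        case 1 show ?thesis by (rule that[of 1 2]; use 1 in linarith)
      next
        case 2 show ?thesis by (rule that[of 0 2]; use 2 in linarith)
      next
        case 3 show ?thesis by (rule that[of 0 1]; use 3 in linarith)
      qed
    qed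
    have xc: "x \<in> carrier G" using X_closed i x .
    define a where "a l = D (z l) (b x) - D x (\<psi> l)" for l
    have a: "a l \<in> A" if "l < 3" "l \<noteq> i" for l
    proof -
      have "D (z l) (b x) - D x (b (z l)) \<in> A"
        by (intro b_commute z_closed xc X_commute[of l i] z_mem x) (use that i in auto)
      moreover have "D x (\<psi> l) - D x (b (z l)) \<in> A"
        using D_mem[OF xc \<psi>(1)[OF that(1)]] xc by (simp add: D_diff)
      ultimately show ?thesis using diff_mem by (fastforce simp: a_def)
    qed
    \<comment> \<open>The \<open>b x\<close> terms agree by commutation, the others by the symmetry
      of \<open>D (z k) (\<psi> j)\<close>.\<close>
    have "D (z k) (a j) = D (z j) (a k)"
    proof -
      have "D (z k) (D x (\<psi> j)) = D x (D (z k) (\<psi> j))"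
        "D (z j) (D x (\<psi> k)) = D x (D (z j) (\<psi> k))"
        "D (z k) (D (z j) (b x)) = D (z j) (D (z k) (b x))"
        using D_X_commute[of k i "z k" x] D_X_commute[of j i "z j" x]
          D_X_commute[of k j "z k" "z j"] jk i x z_mem by auto
      then show ?thesis using jk \<psi>(2)[of j k] by (simp add: a_def D_diff z_closed)
    qed
    then obtain c where c: "c \<in> A" "a j = D (z j) c" "a k = D (z k) c"
      using z_primitive[of j k "a j" "a k"] a jk by metis
    have "D (z l) (b x - c) = D x (\<psi> l)" if "l < 3" "l \<noteq> i" for l
      using all[OF that] c jk by (auto simp: D_diff z_closed a_def algebra_simps)
    moreover have "b x - c - b x \<in> A" using diff_mem[OF zero_mem c(1)] by simp
    ultimately show ?thesis by blast
  qed
  then obtain B where B: "\<And>i x. \<lbrakk>i < 3; x \<in> X i\<rbrakk> \<Longrightarrow> B i x - b x \<in> A"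
    "\<And>i j x. \<lbrakk>i < 3; x \<in> X i; j < 3; j \<noteq> i\<rbrakk> \<Longrightarrow> D (z j) (B i x) = D x (\<psi> j)"
    by metis
  \<comment> \<open>The difference lies in \<open>A\<close>, and the third element detects it:
    \<open>z k - 1\<close> sends both sides to \<open>D x (D y (\<psi> k))\<close>.\<close>
  have B_commute: "D x (B j y) = D y (B i x)"
    if ij: "i < 3" "j < 3" "i \<noteq> j" and x: "x \<in> X i" and y: "y \<in> X j" for i j x y
  proof -
    obtain k :: nat where k: "k < 3" "k \<noteq> i" "k \<noteq> j"
    proof (cases "0 \<in> {i, j}")
      case True
      then show ?thesis using that[of 1] that[of 2] ij by fastforce
    qed (use that[of 0] in auto)
    have xc: "x \<in> carrier G" and yc: "y \<in> carrier G" using X_closed ij x y by blast+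
    have 1: "D x (b y) - D y (b x) \<in> A"
      by (intro b_commute xc yc X_commute[of i j] ij x y)
    have 2: "D x (B j y) - D x (b y) \<in> A" "D y (B i x) - D y (b x) \<in> A"
      using D_mem[OF xc B(1)[OF ij(2) y]] D_mem[OF yc B(1)[OF ij(1) x]] xc yc
      by (simp_all add: D_diff)
    have "D x (B j y) - D y (B i x) \<in> A"
      using diff_mem[OF add_mem[OF 2(1) 1] 2(2)] by simp
    moreover have "D (z k) (D x (B j y) - D y (B i x)) = 0"
    proof -
      have "D (z k) (D x (B j y)) = D x (D y (\<psi> k))" "D (z k) (D y (B i x)) = D y (D x (\<psi> k))"
        using D_X_commute[of k i "z k" x] D_X_commute[of k j "z k" y] B(2) ij k x y z_mem by auto
      then show ?thesis
        using D_X_commute[of i j x y] ij x y k by (simp add: D_diff z_closed)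
    qed
    ultimately show ?thesis using regular_1[OF k(1)] by fastforce
  qed
  \<comment> \<open>The second condition is what y g = g (g^-1 y g) imposes on the value at
    \<open>g\<close> of a derivation that agrees with \<open>B i\<close> on
    \<open>X i\<close>.\<close>
  define P where "P g v \<longleftrightarrow> v - b g \<in> A \<and>
      (\<forall>i<3. \<forall>y\<in>X i. D y v = act g (B i (inv g \<otimes> y \<otimes> g)) - B i y)" for g v
  \<comment> \<open>The equation at \<open>z 0\<close> is enough, as \<open>z 0 - 1\<close> is
    injective on \<open>A\<close>.\<close>
  have P_unique: "v = w" if "P g v" "P g w" for g v w
  proof -
    have "v - w \<in> A" using diff_mem[of "v - b g" "w - b g"] that by (simp add: P_def)
    moreover have "D (z 0) u = act g (B 0 (inv g \<otimes> z 0 \<otimes> g)) - B 0 (z 0)" if "P g u" for u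
      using that z_mem[of 0] by (simp add: P_def)
    then have "D (z 0) (v - w) = 0" using that z_closed[of 0] by (simp add: D_diff)
    ultimately show ?thesis using regular_1[of 0 "v - w"] by simp
  qed
  have P_ex: "\<exists>v. P g v" if g: "g \<in> carrier G" for g
  proof -
    define a where "a i y = D y (b g) - act g (B i (inv g \<otimes> y \<otimes> g)) + B i y" for i y
    have a: "a i y \<in> A" if i: "i < 3" and y: "y \<in> X i" for i y
    proof -
      have "act g (B i (inv g \<otimes> y \<otimes> g)) - act g (b (inv g \<otimes> y \<otimes> g)) \<in> A"
        using act_mem[OF g B(1)[OF i X_conj[OF i y g]]] g by (simp add: act_diff)
      from add_mem[OF diff_mem[OF b_conj[OF g X_closed[OF i y]] this] B(1)[OF i y]]
      show ?thesis by (simp add: a_def algebra_simps)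
    qed
    \<comment> \<open>The \<open>b g\<close> terms match by commutation, the others by
      \<open>B_commute\<close> at \<open>x\<close>, \<open>y\<close> and at their conjugates by
      \<open>g\<close>.\<close>
    have a_commute: "D x (a j y) = D y (a i x)"
      if ij: "i < 3" "j < 3" "i \<noteq> j" and x: "x \<in> X i" and y: "y \<in> X j" for i j x y
    proof -
      have xc: "x \<in> carrier G" and yc: "y \<in> carrier G" using X_closed ij x y by blast+
      show ?thesis
        using D_X_commute[OF ij x y, of "b g"] B_commute[OF ij x y]
          B_commute[OF ij X_conj[OF ij(1) x g] X_conj[OF ij(2) y g]] xc yc g
        by (simp add: a_def D_diff D_add D_act_conj)
    qed
    obtain c where c: "c \<in> A" "a 0 (z 0) = D (z 0) c" "a 1 (z 1) = D (z 1) c"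
      using z_primitive[of 0 1 "a 0 (z 0)" "a 1 (z 1)"] a a_commute[of 1 0 "z 1" "z 0"] z_mem
      by auto
    have "a i y = D y c" if i: "i < 3" and y: "y \<in> X i" for i y
    proof -
      \<comment> \<open>\<open>j\<close> is 1 if \<open>i = 0\<close> and 0 otherwise: an index
        other than \<open>i\<close> at which \<open>c\<close> is known to be a primitive, so that
        \<open>z j - 1\<close> can be cancelled.\<close>
      obtain j :: nat where j: "j < 2" "j < 3" "j \<noteq> i"
        by (cases "i = 0"; rule that[of "of_bool (i = 0)"]) auto
      then have "a j (z j) = D (z j) c" using c by (auto simp: less_2_cases_iff)
      then have "D (z j) (a i y - D y c) = 0"
        using a_commute[of j i "z j" y] D_X_commute[of j i "z j" y c] j i y z_mem
        by (simp add: D_diff z_closed)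
      then show ?thesis
        using regular_1[of j "a i y - D y c"] j a[OF i y] c(1) X_closed[OF i y]
        by (simp add: diff_mem D_mem)
    qed
    then have "P g (b g - c)"
      using diff_mem[OF zero_mem c(1)] X_closed
      by (auto simp: P_def D_diff a_def algebra_simps)
    then show ?thesis by blast
  qed
  define c where "c g = (SOME v. P g v)" for g
  have c: "P g (c g)" if "g \<in> carrier G" for g
    unfolding c_def using someI_ex[OF P_ex[OF that]] .
  show ?thesis
  proof (rule that)
    show "c g - b g \<in> A" if "g \<in> carrier G" for g
      using c[OF that] by (simp add: P_def)
    show "c (g \<otimes> h) = c g + act g (c h)" if g: "g \<in> carrier G" and h: "h \<in> carrier G" for g h
    \<comment> \<open>Both sides satisfy \<open>P (g \<otimes> h)\<close>, so the derivation law
      follows from uniqueness.\<close>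
    proof (rule P_unique)
      show "P (g \<otimes> h) (c (g \<otimes> h))" using c g h by simp
      have "c g - b g \<in> A" "c h - b h \<in> A" using c g h by (simp_all add: P_def)
      from add_mem[OF add_mem[OF this(1) act_mem[OF g this(2)]] b[OF g h]]
      have mem: "c g + act g (c h) - b (g \<otimes> h) \<in> A"
        using g by (simp add: act_diff algebra_simps)
      \<comment> \<open>\<open>D_act_conj\<close> replaces \<open>y\<close> by \<open>?y\<close> in
        the second summand; the terms with \<open>B i ?y\<close> then cancel.\<close>
      have "D y (c g + act g (c h)) =
          act (g \<otimes> h) (B i (inv (g \<otimes> h) \<otimes> y \<otimes> (g \<otimes> h))) - B i y"
        if i: "i < 3" and y: "y \<in> X i" for i y
      proof -
        let ?y = "inv g \<otimes> y \<otimes> g"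
        have yc: "y \<in> carrier G" and y': "?y \<in> X i"
          using X_closed[OF i y] X_conj[OF i y g] .
        have conj: "inv h \<otimes> ?y \<otimes> h = inv (g \<otimes> h) \<otimes> y \<otimes> (g \<otimes> h)"
          using g h yc by (simp add: inv_mult_group m_assoc)
        have "D y (c g) = act g (B i ?y) - B i y"
          using c[OF g] i y by (simp add: P_def)
        moreover have "D ?y (c h) = act h (B i (inv h \<otimes> ?y \<otimes> h)) - B i ?y"
          using c[OF h] i y' by (simp add: P_def)
        ultimately show ?thesis
          using g h yc by (simp add: D_add D_act_conj act_diff act_mult conj)
      qed
      then show "P (g \<otimes> h) (c g + act g (c h))" using mem by (simp add: P_def)
    qed
  qed
qed

end

end


section \<open>Regularity of the group ring\<close>

context group
begin

text \<open>Left translation. The value 0 outside the carrier makes the product law hold for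
  arbitrary functions on the type.\<close>

definition translate :: "'a \<Rightarrow> ('a \<Rightarrow> int) \<Rightarrow> 'a \<Rightarrow> int"
  where "translate g \<phi> = (\<lambda>x. if x \<in> carrier G then \<phi> (inv g \<otimes> x) else 0)"

definition finsupp :: "('a \<Rightarrow> int) set"
  where "finsupp = {\<phi>. finite {x. \<phi> x \<noteq> 0} \<and> {x. \<phi> x \<noteq> 0} \<subseteq> carrier G}"

lemma relative_module_translate: "relative_module G translate finsupp"
proof unfold_locales
  fix g \<phi> assume g: "g \<in> carrier G" and \<phi>: "\<phi> \<in> finsupp"
  have "{x. translate g \<phi> x \<noteq> 0} \<subseteq> (\<lambda>y. g \<otimes> y) ` {y. \<phi> y \<noteq> 0}"
  proof
    fix x assume "x \<in> {x. translate g \<phi> x \<noteq> 0}"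
    then have "x \<in> carrier G" "\<phi> (inv g \<otimes> x) \<noteq> 0"
      by (auto simp: translate_def split: if_splits)
    moreover have "x = g \<otimes> (inv g \<otimes> x)"
      using g \<open>x \<in> carrier G\<close> by (simp add: m_assoc[symmetric])
    ultimately show "x \<in> (\<lambda>y. g \<otimes> y) ` {y. \<phi> y \<noteq> 0}" by blast
  qed
  then show "translate g \<phi> \<in> finsupp"
    using \<phi> by (auto simp: finsupp_def translate_def split: if_splits intro: finite_subset)
next
  fix \<phi> \<psi> assume "\<phi> \<in> finsupp" "\<psi> \<in> finsupp"
  moreover have "{x. (\<phi> - \<psi>) x \<noteq> 0} \<subseteq> {x. \<phi> x \<noteq> 0} \<union> {x. \<psi> x \<noteq> 0}" by auto
  ultimately show "\<phi> - \<psi> \<in> finsupp"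
    unfolding finsupp_def by (blast intro: finite_subset)
qed (auto simp: translate_def finsupp_def inv_mult_group m_assoc fun_eq_iff)

end

section \<open>Grading functions by a homomorphism to the integers\<close>

definition level_part :: "('a \<Rightarrow> int) \<Rightarrow> int \<Rightarrow> ('a \<Rightarrow> int) \<Rightarrow> 'a \<Rightarrow> int"
  where "level_part \<chi> k \<phi> = (\<lambda>x. if \<chi> x = k then \<phi> x else 0)"

context group
begin

interpretation relative_module G translate finsupp
  by (rule relative_module_translate)

lemma level_part_finsupp: "\<phi> \<in> finsupp \<Longrightarrow> level_part \<chi> k \<phi> \<in> finsupp"
  by (auto simp: finsupp_def level_part_def elim!: rev_finite_subset)

lemma hom_integer_inv_mult:
  assumes "\<chi> \<in> hom G integer_group" "w \<in> carrier G" "x \<in> carrier G"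
  shows "\<chi> (inv w \<otimes> x) = \<chi> x - \<chi> w"
proof -
  have "\<chi> (w \<otimes> (inv w \<otimes> x)) = \<chi> w + \<chi> (inv w \<otimes> x)"
    using hom_mult[OF assms(1)] assms by simp
  then show ?thesis using assms by (simp add: m_assoc[symmetric])
qed

text \<open>Translation by an element of the kernel of \<open>\<chi>\<close> moves points within
  their level.\<close>

lemma level_part_D:
  assumes "\<chi> \<in> hom G integer_group" "w \<in> carrier G" "\<chi> w = 0"
  shows "level_part \<chi> k (D w \<phi>) = D w (level_part \<chi> k \<phi>)"
  using assms by (auto simp: level_part_def D_def translate_def fun_eq_iff hom_integer_inv_mult)

text \<open>Since \<open>z\<close> raises levels by one, the lowest level of \<open>(z - 1) \<phi>\<close> is minus the lowest
  level of \<open>\<phi>\<close>; peeling it off decreases the support.\<close>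

lemma regular_mod:
  assumes \<chi>: "\<chi> \<in> hom G integer_group" and z: "z \<in> carrier G" "\<chi> z = 1"
    and zero: "0 \<in> I" and diff: "\<And>\<phi> \<psi>. \<lbrakk>\<phi> \<in> I; \<psi> \<in> I\<rbrakk> \<Longrightarrow> \<phi> - \<psi> \<in> I"
    and translate: "\<And>\<phi>. \<phi> \<in> I \<Longrightarrow> translate z \<phi> \<in> I"
    and level: "\<And>\<phi> k. \<phi> \<in> I \<Longrightarrow> level_part \<chi> k \<phi> \<in> I"
    and \<phi>: "\<phi> \<in> finsupp" "D z \<phi> \<in> I"
  shows "\<phi> \<in> I"
proof -
  \<comment> \<open>Induction on the width \<open>n\<close> of a window of levels that contains the
    support.\<close>
  have levels: "\<phi> \<in> I"
    if "\<And>x. \<phi> x \<noteq> 0 \<Longrightarrow> m \<le> \<chi> x \<and> \<chi> x < m + int n" "\<phi> \<in> finsupp" "D z \<phi> \<in> I" for m n \<phi>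
    using that
  proof (induction n arbitrary: m \<phi>)
    case 0
    then have "\<phi> = 0" by (fastforce simp: fun_eq_iff)
    with zero show ?case by (simp only:)
  next
    case (Suc n)
    let ?\<mu> = "level_part \<chi> m \<phi>"
    have "level_part \<chi> m (D z \<phi>) x = (0 - ?\<mu>) x" for x
    proof (cases "x \<in> carrier G")
      case True
      then have "\<chi> (inv z \<otimes> x) = \<chi> x - 1" using hom_integer_inv_mult[OF \<chi> z(1)] z by simp
      then have "\<phi> (inv z \<otimes> x) = 0" if "\<chi> x = m" using Suc.prems(1)[of "inv z \<otimes> x"] that by auto
      then show ?thesis using True by (simp add: level_part_def D_def translate_def)
    qed (simp add: level_part_def D_def translate_def)
    then have "level_part \<chi> m (D z \<phi>) = 0 - ?\<mu>" by (simp only: fun_eq_iff) blast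
    then have neg: "0 - ?\<mu> \<in> I" using level[OF Suc.prems(3)] by metis
    then have \<mu>: "?\<mu> \<in> I" using diff[OF zero neg] by simp
    have "\<phi> - ?\<mu> \<in> I"
    proof (rule Suc.IH[where m = "m + 1"])
      fix x assume "(\<phi> - ?\<mu>) x \<noteq> 0"
      then show "m + 1 \<le> \<chi> x \<and> \<chi> x < m + 1 + int n"
        using Suc.prems(1)[of x] by (auto simp: level_part_def split: if_splits)
    next
      show "\<phi> - ?\<mu> \<in> finsupp" using Suc.prems(2) by (simp add: diff_mem level_part_finsupp)
      \<comment> \<open>\<open>D z ?\<mu>\<close> lies in \<open>I\<close>, because \<open>I\<close>
        is closed under translation by \<open>z\<close> and under differences.\<close>
      show "D z (\<phi> - ?\<mu>) \<in> I"
        using diff[OF Suc.prems(3) diff[OF translate[OF \<mu>] \<mu>]] z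
        by (simp add: D_diff D_def[of z "?\<mu>"])
    qed
    from diff[OF this neg] show ?case by simp
  qed
  obtain K where K: "\<And>x. \<phi> x \<noteq> 0 \<Longrightarrow> \<bar>\<chi> x\<bar> \<le> K"
  proof -
    have "bdd_above ((\<lambda>x. \<bar>\<chi> x\<bar>) ` {x. \<phi> x \<noteq> 0})"
      using \<phi>(1) by (intro bdd_above_finite finite_imageI) (simp add: finsupp_def)
    then show ?thesis using that by (auto simp: bdd_above_def)
  qed
  show ?thesis
  \<comment> \<open>The levels from \<open>- K\<close> to \<open>K\<close> inclusive fill a
    half-open window of width \<open>2 * K + 1\<close>.\<close>
  proof (rule levels[of \<phi> "- K" "nat (2 * K + 1)"])
    fix x assume "\<phi> x \<noteq> 0"
    from K[OF this] show "- K \<le> \<chi> x \<and> \<chi> x < - K + int (nat (2 * K + 1))" by linarith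
  qed (use \<phi> in auto)
qed

end

text \<open>The \<open>\<chi> i\<close> are dual to the \<open>z j\<close>: in the grading by
  \<open>\<chi> i\<close>, translation by \<open>z i\<close> raises levels by one and translation by
  the other \<open>z j\<close> preserves them.\<close>

locale independent_classes = group G for G (structure) +
  fixes z :: "nat \<Rightarrow> 'a" and X :: "nat \<Rightarrow> 'a set" and \<chi> :: "nat \<Rightarrow> 'a \<Rightarrow> int"
  assumes z_mem: "i < 3 \<Longrightarrow> z i \<in> X i"
    and X_carrier: "i < 3 \<Longrightarrow> X i \<subseteq> carrier G"
    and X_conj: "\<lbrakk>i < 3; x \<in> X i; g \<in> carrier G\<rbrakk> \<Longrightarrow> inv g \<otimes> x \<otimes> g \<in> X i"
    and X_commute: "\<lbrakk>i < 3; j < 3; i \<noteq> j; x \<in> X i; y \<in> X j\<rbrakk> \<Longrightarrow> x \<otimes> y = y \<otimes> x"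
    and \<chi>_hom: "i < 3 \<Longrightarrow> \<chi> i \<in> hom G integer_group"
    and \<chi>_z: "\<lbrakk>i < 3; j < 3\<rbrakk> \<Longrightarrow> \<chi> i (z j) = of_bool (i = j)"
begin

interpretation R: relative_module G translate finsupp
  by (rule relative_module_translate)

text \<open>All three regularity conditions come from \<open>regular_mod\<close>, with
  \<open>I\<close> zero, the image of one \<open>z j - 1\<close>, or the sum of two such images.
  Level parts preserve \<open>I\<close> since the \<open>z j\<close> in question have level
  0.\<close>

lemma commuting_regular_translate: "commuting_regular G translate finsupp z X"
proof unfold_locales
  have z_closed: "z i \<in> carrier G" if "i < 3" for i
    using z_mem X_carrier that by blast
  have z_commute: "z i \<otimes> z j = z j \<otimes> z i" if "i < 3" "j < 3" for i j
    using X_commute[of i j] z_mem that by (cases "i = j") auto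
  have image: "\<phi> \<in> R.D (z j) ` finsupp"
    if "i < 3" "j < 3" "i \<noteq> j" "\<phi> \<in> finsupp" "R.D (z i) \<phi> \<in> R.D (z j) ` finsupp" for i j \<phi>
  proof (rule regular_mod[where \<chi> = "\<chi> i" and z = "z i"])
    show "\<phi> - \<psi> \<in> R.D (z j) ` finsupp"
      if "\<phi> \<in> R.D (z j) ` finsupp" "\<psi> \<in> R.D (z j) ` finsupp" for \<phi> \<psi>
      using that \<open>j < 3\<close> by (force simp: R.D_diff[symmetric] z_closed intro: R.diff_mem)
    show "0 \<in> R.D (z j) ` finsupp"
      using R.D_zero[OF z_closed] R.zero_mem that by (metis imageI)
  qed (use that in \<open>auto simp: \<chi>_hom \<chi>_z z_closed z_commute R.act_D_commute level_part_D
      level_part_finsupp R.act_mem\<close>)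
  show "\<exists>c\<in>finsupp. a = R.D (z j) c"
    if "i < 3" "j < 3" "i \<noteq> j" "a \<in> finsupp" "b \<in> finsupp" "R.D (z i) a = R.D (z j) b" for i j a b
    using image[of i j a] that by blast
  show "a = 0" if "i < 3" "a \<in> finsupp" "R.D (z i) a = 0" for i a
  proof -
    have level: "level_part (\<chi> i) k 0 = 0" for k
      by (simp add: level_part_def fun_eq_iff)
    have "a \<in> {0}"
      by (rule regular_mod[where \<chi> = "\<chi> i" and z = "z i"])
        (use that in \<open>auto simp: \<chi>_hom \<chi>_z z_closed R.act_zero level\<close>)
    then show ?thesis by simp
  qed
  define I where "I = {R.D (z 0) b + R.D (z 1) c |b c. b \<in> finsupp \<and> c \<in> finsupp}"
  have I_mem: "R.D (z 0) b + R.D (z 1) c \<in> I" if "b \<in> finsupp" "c \<in> finsupp" for b c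
    using that by (auto simp: I_def)
  show "\<exists>b'\<in>finsupp. \<exists>c'\<in>finsupp. a = R.D (z 0) b' + R.D (z 1) c'"
    if a: "a \<in> finsupp" and b: "b \<in> finsupp" and c: "c \<in> finsupp"
      and eq: "R.D (z 2) a = R.D (z 0) b + R.D (z 1) c" for a b c
  proof -
    have "a \<in> I"
    proof (rule regular_mod[where \<chi> = "\<chi> 2" and z = "z 2"])
      show "0 \<in> I" using I_mem[OF R.zero_mem R.zero_mem] by (simp add: R.D_zero z_closed)
      show "\<phi> - \<psi> \<in> I" if \<phi>: "\<phi> \<in> I" and \<psi>: "\<psi> \<in> I" for \<phi> \<psi>
      proof -
        obtain b c b' c' where "b \<in> finsupp" "c \<in> finsupp" "\<phi> = R.D (z 0) b + R.D (z 1) c"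
          "b' \<in> finsupp" "c' \<in> finsupp" "\<psi> = R.D (z 0) b' + R.D (z 1) c'"
          using \<phi> \<psi> by (auto simp: I_def)
        then show ?thesis
          using I_mem[of "b - b'" "c - c'"] by (simp add: R.diff_mem R.D_diff z_closed algebra_simps)
      qed
      show "translate (z 2) \<phi> \<in> I" if "\<phi> \<in> I" for \<phi>
        using that
        by (auto simp: I_def R.act_add z_closed z_commute R.act_D_commute simp del: One_nat_def)
          (metis R.act_mem z_closed lessI numeral_3_eq_3 numeral_2_eq_2)
      show "level_part (\<chi> 2) k \<phi> \<in> I" if \<phi>: "\<phi> \<in> I" for \<phi> k
      proof -
        obtain b c where bc: "b \<in> finsupp" "c \<in> finsupp" "\<phi> = R.D (z 0) b + R.D (z 1) c"
          using \<phi> by (auto simp: I_def)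
        have "level_part (\<chi> 2) k \<phi> =
            level_part (\<chi> 2) k (R.D (z 0) b) + level_part (\<chi> 2) k (R.D (z 1) c)"
          by (auto simp: bc level_part_def fun_eq_iff)
        then show ?thesis
          using I_mem[of "level_part (\<chi> 2) k b" "level_part (\<chi> 2) k c"] bc
          by (simp add: level_part_D \<chi>_hom \<chi>_z z_closed level_part_finsupp)
      qed
    qed (use a b c eq I_mem in \<open>auto simp: \<chi>_hom \<chi>_z z_closed\<close>)
    then show ?thesis by (auto simp: I_def)
  qed
qed (use z_mem X_carrier X_conj X_commute in auto)

end

section \<open>Group cohomology with group ring coefficients\<close>

context group
begin

interpretation R: ring "group_ring G"
  by (rule ring_group_ring) (rule is_group)

interpretation M: group_module G "group_ring_module G"
  by (rule group_module_group_ring) (rule is_group)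

text \<open>Links the group ring module to \<open>finsupp\<close> with \<open>translate\<close>. By
  linearity only \<open>frag_of h\<close> matters, where y = g h iff g^-1 y = h.\<close>

lemma lookup_group_ring_act:
  assumes g: "g \<in> carrier G" and x: "Poly_Mapping.keys x \<subseteq> carrier G"
  shows "Poly_Mapping.lookup (frag_of g \<otimes>\<^bsub>group_ring G\<^esub> x) = translate g (Poly_Mapping.lookup x)"
  using x
proof (induction x rule: frag_induction)
  case zero
  show ?case by (simp add: group_ring_mult_distrib' translate_def fun_eq_iff)
next
  case (one h)
  have "y = g \<otimes> h \<longleftrightarrow> inv g \<otimes> y = h" if "y \<in> carrier G" for y
    using that g one by (metis inv_solve_left)
  then show ?case
    using g one
    by (auto simp: group_ring_mult_of translate_def fun_eq_iff lookup_single when_def)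
next
  case (diff a b)
  then show ?case
    by (simp add: group_ring_mult_distrib' lookup_minus translate_def fun_eq_iff)
qed

lemma group_ring_module_minus:
  assumes "x \<in> carrier (group_ring G)" "y \<in> carrier (group_ring G)"
  shows "x \<ominus>\<^bsub>group_ring_module G\<^esub> y = x - y"
proof -
  have "\<ominus>\<^bsub>group_ring_module G\<^esub> y = - y"
    using assms(2) by (intro M.M.minus_equality) auto
  then show ?thesis by (simp add: a_minus_def)
qed

section \<open>Cochains and coboundaries in low degrees\<close>

lemma cochains_group_ring:
  assumes "f \<in> carrier (cochains n G (group_ring_module G))" "gs \<in> tuples G n"
  shows "f gs \<in> carrier (group_ring G)"
  using assms by (auto simp: cochains_def)

lemma group_ring_act_closed:
  "\<lbrakk>g \<in> carrier G; x \<in> carrier (group_ring G)\<rbrakk> \<Longrightarrow>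
    frag_of g \<otimes>\<^bsub>group_ring G\<^esub> x \<in> carrier (group_ring G)"
  using M.act_closed by simp

lemma group_ring_diff_closed:
  "\<lbrakk>x \<in> carrier (group_ring G); y \<in> carrier (group_ring G)\<rbrakk> \<Longrightarrow> x - y \<in> carrier (group_ring G)"
  using keys_diff[of x y] by auto

lemma group_ring_add_closed:
  "\<lbrakk>x \<in> carrier (group_ring G); y \<in> carrier (group_ring G)\<rbrakk> \<Longrightarrow> x + y \<in> carrier (group_ring G)"
  using R.a_closed by simp

lemmas group_ring_closed = group_ring_act_closed group_ring_diff_closed group_ring_add_closed

lemma coboundary_1_group_ring:
  assumes f: "f \<in> carrier (cochains 1 G (group_ring_module G))" and "g \<in> carrier G" "h \<in> carrier G"
  shows "coboundary 1 G (group_ring_module G) f [g, h] =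
    frag_of g \<otimes>\<^bsub>group_ring G\<^esub> f [h] - f [g \<otimes> h] + f [g]"
proof -
  have "f [x] \<in> carrier (group_ring G)" if "x \<in> carrier G" for x
    using cochains_group_ring[OF f] that by (simp add: tuples_def)
  then show ?thesis
    using M.coboundary_1[OF f] assms
    by (simp add: group_ring_module_minus group_ring_closed del: group_ring_simps(1))
qed

lemma coboundary_2_group_ring:
  assumes f: "f \<in> carrier (cochains 2 G (group_ring_module G))"
    and "g \<in> carrier G" "h \<in> carrier G" "k \<in> carrier G"
  shows "coboundary 2 G (group_ring_module G) f [g, h, k] =
    frag_of g \<otimes>\<^bsub>group_ring G\<^esub> f [h, k] - f [g \<otimes> h, k] + f [g, h \<otimes> k] - f [g, h]"
proof -
  have "f [x, y] \<in> carrier (group_ring G)" if "x \<in> carrier G" "y \<in> carrier G" for x y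
    using cochains_group_ring[OF f] that by (simp add: tuples_def)
  then show ?thesis
    using M.coboundary_2[OF f] assms
    by (simp add: group_ring_module_minus group_ring_closed del: group_ring_simps(1))
qed

lemma tuples_2E: "gs \<in> tuples G 2 \<Longrightarrow>
    (\<And>g h. \<lbrakk>gs = [g, h]; g \<in> carrier G; h \<in> carrier G\<rbrakk> \<Longrightarrow> thesis) \<Longrightarrow> thesis"
  by (auto simp: tuples_def length_Suc_conv numeral_2_eq_2)

lemma tuples_3E: "gs \<in> tuples G 3 \<Longrightarrow>
    (\<And>g h k. \<lbrakk>gs = [g, h, k]; g \<in> carrier G; h \<in> carrier G; k \<in> carrier G\<rbrakk> \<Longrightarrow> thesis) \<Longrightarrow> thesis"
  by (auto simp: tuples_def length_Suc_conv numeral_3_eq_3)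

lemma coboundary_extensional: "coboundary n G M f \<in> extensional (tuples G (Suc n))"
  by (simp add: coboundary_def)

lemma coboundary_1_closed:
  assumes f: "f \<in> carrier (cochains 1 G (group_ring_module G))"
  shows "coboundary 1 G (group_ring_module G) f \<in> carrier (cochains 2 G (group_ring_module G))"
proof -
  have f': "f [x] \<in> carrier (group_ring G)" if "x \<in> carrier G" for x
    using cochains_group_ring[OF f] that by (simp add: tuples_def)
  have "coboundary 1 G (group_ring_module G) f gs \<in> carrier (group_ring G)"
    if "gs \<in> tuples G 2" for gs
    using that
    by (rule tuples_2E)
      (simp add: coboundary_1_group_ring[OF f] f' group_ring_closed
        del: group_ring_simps(1) One_nat_def)
  then show ?thesis
    using coboundary_extensional[of 1 "group_ring_module G" f]
    by (auto simp: cochains_def PiE_iff numeral_2_eq_2)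
qed

lemma coboundary_2_closed:
  assumes f: "f \<in> carrier (cochains 2 G (group_ring_module G))"
  shows "coboundary 2 G (group_ring_module G) f \<in> carrier (cochains 3 G (group_ring_module G))"
proof -
  have f': "f [x, y] \<in> carrier (group_ring G)" if "x \<in> carrier G" "y \<in> carrier G" for x y
    using cochains_group_ring[OF f] that by (simp add: tuples_def)
  have "coboundary 2 G (group_ring_module G) f gs \<in> carrier (group_ring G)"
    if "gs \<in> tuples G 3" for gs
    using that
    by (rule tuples_3E)
      (simp add: coboundary_2_group_ring[OF f] f' group_ring_closed del: group_ring_simps(1))
  then show ?thesis
    using coboundary_extensional[of 2 "group_ring_module G" f]
    by (auto simp: cochains_def PiE_iff numeral_3_eq_3 numeral_2_eq_2)
qed

lemma group_cochains: "group (cochains n G (group_ring_module G))"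
  unfolding cochains_def by (intro product_group M.M.a_group)

text \<open>Makes the cocycles, as a kernel, a subgroup, so that the quotient by the coboundaries
  can be treated as a quotient of a group.\<close>

lemma group_hom_coboundary_2:
  "group_hom (cochains 2 G (group_ring_module G)) (cochains 3 G (group_ring_module G))
    (coboundary 2 G (group_ring_module G))"
proof -
  let ?M = "group_ring_module G"
  interpret C: group "cochains 2 G ?M" by (rule group_cochains)
  have "coboundary 2 G ?M (e \<otimes>\<^bsub>cochains 2 G ?M\<^esub> f) =
      coboundary 2 G ?M e \<otimes>\<^bsub>cochains 3 G ?M\<^esub> coboundary 2 G ?M f"
    if e: "e \<in> carrier (cochains 2 G ?M)" and f: "f \<in> carrier (cochains 2 G ?M)" for e f
  proof (rule extensionalityI)
    fix gs assume gs: "gs \<in> tuples G 3"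
    have add: "(e \<otimes>\<^bsub>cochains 2 G ?M\<^esub> f) [x, y] = e [x, y] + f [x, y]"
      if "x \<in> carrier G" "y \<in> carrier G" for x y
      using that by (simp add: cochains_def tuples_def)
    from gs show "coboundary 2 G ?M (e \<otimes>\<^bsub>cochains 2 G ?M\<^esub> f) gs =
        (coboundary 2 G ?M e \<otimes>\<^bsub>cochains 3 G ?M\<^esub> coboundary 2 G ?M f) gs"
    proof (rule tuples_3E)
      fix g h k assume "gs = [g, h, k]" and [simp]: "g \<in> carrier G" "h \<in> carrier G" "k \<in> carrier G"
      moreover from this gs have "(coboundary 2 G ?M e \<otimes>\<^bsub>cochains 3 G ?M\<^esub> coboundary 2 G ?M f) gs =
          coboundary 2 G ?M e [g, h, k] + coboundary 2 G ?M f [g, h, k]"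
        by (simp add: cochains_def)
      ultimately show ?thesis
        by (simp add: coboundary_2_group_ring[OF C.m_closed[OF e f]] coboundary_2_group_ring[OF e]
            coboundary_2_group_ring[OF f] add group_ring_mult_distrib' algebra_simps)
    qed
  qed (auto simp: coboundary_def cochains_def numeral_3_eq_3 numeral_2_eq_2)
  then show ?thesis
    using coboundary_2_closed group_cochains
    by (auto simp: group_hom_def group_hom_axioms_def hom_def)
qed

text \<open>Two successive coboundary maps compose to zero, by expansion on triples.\<close>

lemma coboundaries_2_subset:
  "coboundaries 2 G (group_ring_module G) \<subseteq> cocycles 2 G (group_ring_module G)"
proof
  let ?M = "group_ring_module G"
  fix e assume "e \<in> coboundaries 2 G ?M"
  then obtain f where f: "f \<in> carrier (cochains 1 G ?M)" and e: "e = coboundary 1 G ?M f"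
    by (auto simp: coboundaries_def numeral_2_eq_2)
  have e_mem: "e \<in> carrier (cochains 2 G ?M)" using coboundary_1_closed[OF f] e by simp
  have f': "f [x] \<in> carrier (group_ring G)" if "x \<in> carrier G" for x
    using cochains_group_ring[OF f] that by (simp add: tuples_def)
  have assoc: "frag_of (g \<otimes> h) \<otimes>\<^bsub>group_ring G\<^esub> x =
      frag_of g \<otimes>\<^bsub>group_ring G\<^esub> (frag_of h \<otimes>\<^bsub>group_ring G\<^esub> x)"
    if "g \<in> carrier G" "h \<in> carrier G" "x \<in> carrier (group_ring G)" for g h x
    using M.act_mult[of g h x] that by simp
  have "coboundary 2 G ?M e = \<one>\<^bsub>cochains 3 G ?M\<^esub>"
  proof (rule extensionalityI)
    fix gs assume gs: "gs \<in> tuples G 3"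
    then show "coboundary 2 G ?M e gs = \<one>\<^bsub>cochains 3 G ?M\<^esub> gs"
    proof (rule tuples_3E)
      fix g h k assume "gs = [g, h, k]" and [simp]: "g \<in> carrier G" "h \<in> carrier G" "k \<in> carrier G"
      moreover from this gs have "\<one>\<^bsub>cochains 3 G ?M\<^esub> gs = 0" by (simp add: cochains_def)
      moreover have e_eq: "e [x, y] = frag_of x \<otimes>\<^bsub>group_ring G\<^esub> f [y] - f [x \<otimes> y] + f [x]"
        if "x \<in> carrier G" "y \<in> carrier G" for x y
        using coboundary_1_group_ring[OF f that] e by simp
      ultimately show ?thesis
        by (simp add: coboundary_2_group_ring[OF e_mem] group_ring_mult_distrib' assoc f' m_assoc
            del: group_ring_simps(1))
    qed
  qed (auto simp: coboundary_def cochains_def numeral_3_eq_3 numeral_2_eq_2)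
  then show "e \<in> cocycles 2 G ?M"
    using e_mem by (simp add: cocycles_def kernel_def numeral_3_eq_3 numeral_2_eq_2)
qed

section \<open>Vanishing of the second cohomology\<close>

lemma trivial_FactGroup_carrier: "trivial_group (G Mod carrier G)"
proof -
  have "carrier G \<lhd> G" by (simp add: normal_inv_iff subgroup_self)
  moreover have "carrier (G Mod carrier G) = {carrier G}"
    using coset_join2[OF _ subgroup_self] by (auto simp: FactGroup_def RCOSETS_def)
  moreover have "\<one>\<^bsub>G Mod carrier G\<^esub> = carrier G" by (simp add: FactGroup_def)
  ultimately show ?thesis by (simp add: trivial_group_def normal.factorgroup_is_group)
qed

text \<open>With \<open>coboundaries_2_subset\<close> the inclusion becomes an equality, and a group
  modulo itself has one coset.\<close>

lemma trivial_cohomology_2I: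
  assumes "cocycles 2 G (group_ring_module G) \<subseteq> coboundaries 2 G (group_ring_module G)"
  shows "trivial_group (group_cohomology 2 G (group_ring_module G))"
proof -
  let ?M = "group_ring_module G"
  let ?Z = "(cochains 2 G ?M)\<lparr>carrier := cocycles 2 G ?M\<rparr>"
  interpret d: group_hom "cochains 2 G ?M" "cochains 3 G ?M" "coboundary 2 G ?M"
    by (rule group_hom_coboundary_2)
  have "subgroup (cocycles 2 G ?M) (cochains 2 G ?M)"
    using d.subgroup_kernel by (simp add: cocycles_def numeral_3_eq_3 numeral_2_eq_2)
  then interpret Z: group ?Z by (rule d.G.subgroup_imp_group)
  have "coboundaries 2 G ?M = carrier ?Z"
    using assms coboundaries_2_subset by auto
  then show ?thesis
    using Z.trivial_FactGroup_carrier by (simp add: group_cohomology_def)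
qed

end

theorem (in independent_classes) trivial_cohomology_2:
  "trivial_group (group_cohomology 2 G (group_ring_module G))"
proof (rule trivial_cohomology_2I, rule subsetI)
  let ?M = "group_ring_module G"
  interpret commuting_regular G translate finsupp z X by (rule commuting_regular_translate)
  fix f assume "f \<in> cocycles 2 G ?M"
  then have f: "f \<in> carrier (cochains 2 G ?M)"
    and df: "coboundary 2 G ?M f = \<one>\<^bsub>cochains 3 G ?M\<^esub>"
    by (auto simp: cocycles_def kernel_def numeral_3_eq_3 numeral_2_eq_2)
  have keys: "Poly_Mapping.keys (f [g, h]) \<subseteq> carrier G"
    if "g \<in> carrier G" "h \<in> carrier G" for g h
    using cochains_group_ring[OF f, of "[g, h]"] that by (simp add: tuples_def)
  have cocycle: "frag_of g \<otimes>\<^bsub>group_ring G\<^esub> f [h, k] - f [g \<otimes> h, k] + f [g, h \<otimes> k] - f [g, h] = 0"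
    if "g \<in> carrier G" "h \<in> carrier G" "k \<in> carrier G" for g h k
  proof -
    have "[g, h, k] \<in> tuples G 3" using that by (simp add: tuples_def)
    then show ?thesis
      using coboundary_2_group_ring[OF f that] df by (simp add: cochains_def)
  qed
  \<comment> \<open>Evaluating the cocycle identity for \<open>g, h, (g h)\<^sup>-\<^sup>1 x\<close> at \<open>x\<close> shows that \<open>b\<close> cobounds \<open>f\<close>.\<close>
  define b where
    "b g = (\<lambda>x. if x \<in> carrier G then Poly_Mapping.lookup (f [g, inv g \<otimes> x]) x else 0)" for g
  have b: "translate g (b h) - b (g \<otimes> h) + b g = Poly_Mapping.lookup (f [g, h])"
    if g: "g \<in> carrier G" and h: "h \<in> carrier G" for g h
  proof
    fix x
    show "(translate g (b h) - b (g \<otimes> h) + b g) x = Poly_Mapping.lookup (f [g, h]) x"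
    proof (cases "x \<in> carrier G")
      case x: True
      let ?k = "inv (g \<otimes> h) \<otimes> x"
      have k: "?k \<in> carrier G" "?k = inv h \<otimes> (inv g \<otimes> x)" "h \<otimes> ?k = inv g \<otimes> x"
        using g h x by (simp_all add: inv_mult_group m_assoc) (simp add: m_assoc[symmetric])
      have "Poly_Mapping.lookup (frag_of g \<otimes>\<^bsub>group_ring G\<^esub> f [h, ?k] - f [g \<otimes> h, ?k]
          + f [g, h \<otimes> ?k] - f [g, h]) x = 0"
        using cocycle[OF g h k(1)] by simp
      then have "Poly_Mapping.lookup (f [h, ?k]) (inv g \<otimes> x) - Poly_Mapping.lookup (f [g \<otimes> h, ?k]) x
          + Poly_Mapping.lookup (f [g, inv g \<otimes> x]) x - Poly_Mapping.lookup (f [g, h]) x = 0"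
        using lookup_group_ring_act[OF g keys[OF h k(1)]] x k(3)
        by (simp add: lookup_add lookup_minus translate_def)
      then show ?thesis using g h x k(2) by (simp add: b_def translate_def)
    next
      case False
      then show ?thesis using keys[OF g h] by (auto simp: b_def translate_def in_keys_iff)
    qed
  qed
  have finsupp_iff: "\<phi> \<in> finsupp \<longleftrightarrow>
      (\<exists>p. Poly_Mapping.lookup p = \<phi> \<and> Poly_Mapping.keys p \<subseteq> carrier G)" for \<phi> :: "'a \<Rightarrow> int"
  proof
    assume "\<phi> \<in> finsupp"
    then show "\<exists>p. Poly_Mapping.lookup p = \<phi> \<and> Poly_Mapping.keys p \<subseteq> carrier G"
      by (intro exI[of _ "Abs_poly_mapping \<phi>"])
        (auto simp: finsupp_def Abs_poly_mapping_inverse in_keys_iff)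
  qed (auto simp: finsupp_def in_keys_iff)
  obtain c where c: "\<And>g. g \<in> carrier G \<Longrightarrow> c g - b g \<in> finsupp"
    and deriv: "\<And>g h. \<lbrakk>g \<in> carrier G; h \<in> carrier G\<rbrakk> \<Longrightarrow> c (g \<otimes> h) = c g + translate g (c h)"
  proof (rule lift_to_derivation[of b])
    show "translate g (b h) - b (g \<otimes> h) + b g \<in> finsupp" if "g \<in> carrier G" "h \<in> carrier G" for g h
      using b[OF that] keys[OF that] finsupp_iff by auto
  qed (use that in blast)
  \<comment> \<open>\<open>b - c\<close> is valued in the group ring and has the same coboundary as
    \<open>b\<close>, since \<open>c\<close> is a derivation.\<close>
  have "\<exists>p. Poly_Mapping.lookup p = b g - c g \<and> Poly_Mapping.keys p \<subseteq> carrier G"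
    if "g \<in> carrier G" for g
    using diff_mem[OF zero_mem c[OF that]] finsupp_iff by simp
  then obtain p where p: "\<And>g. g \<in> carrier G \<Longrightarrow> Poly_Mapping.lookup (p g) = b g - c g"
    "\<And>g. g \<in> carrier G \<Longrightarrow> Poly_Mapping.keys (p g) \<subseteq> carrier G"
    by metis
  define u where "u = (\<lambda>gs\<in>tuples G 1. p (hd gs))"
  have u: "u \<in> carrier (cochains 1 G ?M)"
    using p(2) by (fastforce simp: u_def cochains_def tuples_def length_Suc_conv)
  have u_eq: "u [g] = p g" if "g \<in> carrier G" for g
    using that by (simp add: u_def tuples_def)
  have "coboundary 1 G ?M u = f"
  proof (rule extensionalityI)
    fix gs assume "gs \<in> tuples G 2"
    then show "coboundary 1 G ?M u gs = f gs"
    proof (rule tuples_2E)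
      fix g h assume gs: "gs = [g, h]" and g: "g \<in> carrier G" and h: "h \<in> carrier G"
      have "Poly_Mapping.lookup (frag_of g \<otimes>\<^bsub>group_ring G\<^esub> p h - p (g \<otimes> h) + p g) =
          translate g (b h - c h) - (b (g \<otimes> h) - c (g \<otimes> h)) + (b g - c g)"
        using g h by (simp add: fun_eq_iff lookup_add lookup_minus lookup_group_ring_act p)
      also have "\<dots> = Poly_Mapping.lookup (f [g, h])"
        using b[OF g h] deriv[OF g h] g by (simp add: act_diff algebra_simps)
      finally show ?thesis
        using coboundary_1_group_ring[OF u g h] g h
        by (simp add: gs u_eq poly_mapping_eqI)
    qed
  qed (use f in \<open>auto simp: coboundary_def cochains_def numeral_2_eq_2 PiE_iff\<close>)
  then show "f \<in> coboundaries 2 G ?M"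
    using u by (auto simp: coboundaries_def numeral_2_eq_2)
qed

section \<open>Stallings' group\<close>

lemma F2_one: "\<one>\<^bsub>F\<^sub>2\<^esub> = []"
  by (simp add: free_group_def)

lemma stallings_group_simps:
  "carrier stallings_group = kernel (F\<^sub>2 \<times>\<times> F\<^sub>2 \<times>\<times> F\<^sub>2) integer_group stallings_hom"
  "(u, v, w) \<otimes>\<^bsub>stallings_group\<^esub> (u', v', w') =
    (u \<otimes>\<^bsub>F\<^sub>2\<^esub> u', v \<otimes>\<^bsub>F\<^sub>2\<^esub> v', w \<otimes>\<^bsub>F\<^sub>2\<^esub> w')"
  by (simp_all add: stallings_group_def)

lemma stallings_group_components:
  assumes "(u, v, w) \<in> carrier stallings_group"
  shows "u \<in> carrier F\<^sub>2" "v \<in> carrier F\<^sub>2" "w \<in> carrier F\<^sub>2"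
  using assms by (auto simp: stallings_group_simps kernel_def)

lemma stallings_group_inv:
  assumes "(u, v, w) \<in> carrier stallings_group"
  shows "inv\<^bsub>stallings_group\<^esub> (u, v, w) = (inv\<^bsub>F\<^sub>2\<^esub> u, inv\<^bsub>F\<^sub>2\<^esub> v, inv\<^bsub>F\<^sub>2\<^esub> w)"
proof -
  interpret group_hom "F\<^sub>2 \<times>\<times> F\<^sub>2 \<times>\<times> F\<^sub>2" integer_group stallings_hom
    using group_F2_cubed stallings_hom_hom by (simp add: group_hom_def group_hom_axioms_def)
  show ?thesis
    using assms stallings_group_components[OF assms] G.m_inv_consistent[OF subgroup_kernel]
    by (simp add: stallings_group_def inv_DirProd group_free_group DirProd_group)
qed

text \<open>\<open>t\<close> is x y^-1 for the two free generators x (\<open>True\<close>) and y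
  (\<open>False\<close>); its exponent sum 0 puts it in the kernel.\<close>

definition factor_gen :: "nat \<Rightarrow> (bool \<times> bool) list \<times> (bool \<times> bool) list \<times> (bool \<times> bool) list"
  where "factor_gen i =
    (let t = [(True, True), (False, False)]
     in if i = 0 then (t, [], []) else if i = 1 then ([], t, []) else ([], [], t))"

text \<open>The kernel intersected with one direct factor, a normal subgroup.\<close>

definition factor :: "nat \<Rightarrow> ((bool \<times> bool) list \<times> (bool \<times> bool) list \<times> (bool \<times> bool) list) set"
  where "factor i = {(u, v, w) \<in> carrier stallings_group.
    (i \<noteq> 0 \<longrightarrow> u = []) \<and> (i \<noteq> 1 \<longrightarrow> v = []) \<and> (i \<noteq> 2 \<longrightarrow> w = [])}"

text \<open>\<open>of_bool\<close> sends the generator \<open>True\<close> to 1 and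
  \<open>False\<close> to 0. Counting only one generator gives 1 on \<open>t\<close>, where the full
  exponent sum vanishes.\<close>

definition factor_hom :: "nat \<Rightarrow> (bool \<times> bool) list \<times> (bool \<times> bool) list \<times> (bool \<times> bool) list \<Rightarrow> int"
  where "factor_hom i =
    (\<lambda>(u, v, w). free_lift integer_group of_bool (if i = 0 then u else if i = 1 then v else w))"

text \<open>Conjugation acts coordinatewise and keeps empty coordinates empty; elements of different
  factors commute because in each coordinate at least one of them is empty.\<close>

lemma independent_classes_stallings_group:
  "independent_classes stallings_group factor_gen factor factor_hom"
proof -
  interpret S: group stallings_group by (rule group_stallings_group)
  interpret F: group F\<^sub>2 by (rule group_free_group)
  have unit: "w \<otimes>\<^bsub>F\<^sub>2\<^esub> [] = w" "[] \<otimes>\<^bsub>F\<^sub>2\<^esub> w = w" "inv\<^bsub>F\<^sub>2\<^esub> w \<otimes>\<^bsub>F\<^sub>2\<^esub> w = []"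
    if "w \<in> carrier F\<^sub>2" for w
    using F.r_one[OF that] F.l_one[OF that] F.l_inv[OF that] unfolding F2_one by auto
  have Nil: "[] \<in> carrier F\<^sub>2" by (simp add: free_group_def)
  show ?thesis
  proof unfold_locales
    fix i j :: nat assume i: "i < 3"
    then consider "i = 0" | "i = 1" | "i = 2" by linarith
    note i_cases = this
    have "[(True, True), (False, False)] \<in> carrier F\<^sub>2"
      by (simp add: free_group_def inv_letter_def)
    then show "factor_gen i \<in> factor i"
      by (cases rule: i_cases)
        (auto simp: factor_gen_def factor_def stallings_group_simps kernel_def Nil
          stallings_hom_def exponent_sum_def)
    show "factor i \<subseteq> carrier stallings_group" by (auto simp: factor_def)
    show "inv\<^bsub>stallings_group\<^esub> g \<otimes>\<^bsub>stallings_group\<^esub> x \<otimes>\<^bsub>stallings_group\<^esub> g \<in> factor i"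
      if x: "x \<in> factor i" and g: "g \<in> carrier stallings_group" for x g
    proof -
      obtain u v w u' v' w' where eq: "x = (u, v, w)" "g = (u', v', w')"
        by (metis surj_pair)
      have "inv\<^bsub>stallings_group\<^esub> g \<otimes>\<^bsub>stallings_group\<^esub> x \<otimes>\<^bsub>stallings_group\<^esub> g \<in> carrier stallings_group"
        using x g by (auto simp: factor_def)
      then show ?thesis
        using x g stallings_group_components[of u' v' w']
        by (auto simp: eq factor_def stallings_group_inv stallings_group_simps(2) unit F2_one)
    qed
    show "factor_hom i \<in> hom stallings_group integer_group"
    proof (rule homI)
      have \<rho>: "free_lift integer_group of_bool \<in> hom F\<^sub>2 integer_group"
        by (rule free_lift_hom) auto
      show "factor_hom i (p \<otimes>\<^bsub>stallings_group\<^esub> q) =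
          factor_hom i p \<otimes>\<^bsub>integer_group\<^esub> factor_hom i q"
        if "p \<in> carrier stallings_group" "q \<in> carrier stallings_group" for p q
      proof -
        obtain u v w u' v' w' where eq: "p = (u, v, w)" "q = (u', v', w')"
          by (metis surj_pair)
        show ?thesis
          using that stallings_group_components[of u v w] stallings_group_components[of u' v' w']
            hom_mult[OF \<rho>]
          by (simp add: eq factor_hom_def stallings_group_simps(2))
      qed
    qed simp
    assume j: "j < 3"
    then consider "j = 0" | "j = 1" | "j = 2" by linarith
    note j_cases = this
    show "x \<otimes>\<^bsub>stallings_group\<^esub> y = y \<otimes>\<^bsub>stallings_group\<^esub> x"
      if "i \<noteq> j" "x \<in> factor i" "y \<in> factor j" for x y
    proof -
      obtain u v w u' v' w' where eq: "x = (u, v, w)" "y = (u', v', w')"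
        by (metis surj_pair)
      show ?thesis
        using that i j stallings_group_components[of u v w] stallings_group_components[of u' v' w']
        by (auto simp: eq factor_def stallings_group_simps(2) unit)
    qed
    show "factor_hom i (factor_gen j) = of_bool (i = j)"
      by (cases rule: i_cases; cases rule: j_cases) (auto simp: factor_hom_def factor_gen_def)
  qed
qed

theorem corollary1p3:
  shows "trivial_group (group_cohomology 2 stallings_group (group_ring_module stallings_group))"
proof -
  interpret independent_classes stallings_group factor_gen factor factor_hom
    by (rule independent_classes_stallings_group)
  show ?thesis by (rule trivial_cohomology_2)
qed

end
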